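(* Let $0<\rho<1$, $0<\alpha<1$ and $\eta>0$. Then, with the threshold $\eta$ kept fixed, the target-portfolio correlation with the raw signal exceeds that with the smoothed signal, $K(0,\eta)>K(\alpha,\eta)$, and the ratio of improvement relative to the correlation of the smoothed (AR(1)) signal satisfies $$\frac{K(0,\eta)-K(\alpha,\eta)}{K(\alpha,\eta)}>\mathcal R(\alpha,\eta),$$ where $$\mathcal R(\alpha,\eta)=\frac{1-\sqrt{1-\alpha^2}+\sqrt{1-\alpha^2}\,F\!\left(\sqrt{\tfrac{1+\alpha}{1-\alpha}}\,\eta\right)-\sqrt{1-\alpha^2}\,F\!\left(\sqrt{\tfrac{1-\alpha}{1+\alpha}}\,\eta\right)}{\sqrt{1-\alpha^2}-\sqrt{1-\alpha^2}\,F\!\left(\sqrt{\tfrac{1+\alpha}{1-\alpha}}\,\eta\right)+\sqrt{1-\alpha^2}\,F\!\left(\sqrt{\tfrac{1-\alpha}{1+\alpha}}\,\eta\right)}.$$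
   Context: $F$ is the standard Gaussian distribution function. Let $(X_t)_{t\in\mathbb Z}$ and $(\varepsilon_t)_{t\in\mathbb Z}$ be two independent sequences of i.i.d. $\mathcal N(0,1)$ random variables, and for $0<\rho<1$ put $Y_t=\rho X_t+\sqrt{1-\rho^2}\,\varepsilon_t$. For $0\le\alpha<1$ define the smoothed signal (exponential moving average) $\tilde X_t=\sqrt{1-\alpha^2}\,\sum_{j\ge0}\alpha^jX_{t-j}$ (with $\alpha^0=1$; so $\tilde X_t=X_t$, the raw signal, when $\alpha=0$). For $\eta>0$ the portfolio $W_t\in\{-1,1\}$ is defined by $W_t=1$ if $\tilde X_t\ge\eta$, $W_t=-1$ if $\tilde X_t\le-\eta$, and $W_t=W_{t-1}$ if $-\eta<\tilde X_t<\eta$ (almost surely this determines $W_t$: it is the sign of $\tilde X_s$ at the last time $s\le t$ with $|\tilde X_s|\ge\eta$). The target-portfolio correlation is $K(\alpha,\eta)=\mathbb E[W_tY_t]$ (independent of $t$ by stationarity). *)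

theory Defs
  imports "HOL-Probability.Probability"
begin

abbreviation std_normal_cdf :: "real \<Rightarrow> real" where
  "std_normal_cdf \<equiv> cdf std_normal_distribution"

definition target :: "real \<Rightarrow> (int \<Rightarrow> 'a \<Rightarrow> real) \<Rightarrow> (int \<Rightarrow> 'a \<Rightarrow> real) \<Rightarrow> int \<Rightarrow> 'a \<Rightarrow> real" where
  "target \<rho> X \<epsilon> t \<omega> = \<rho> * X t \<omega> + sqrt (1 - \<rho>\<^sup>2) * \<epsilon> t \<omega>"

definition ema :: "real \<Rightarrow> (int \<Rightarrow> 'a \<Rightarrow> real) \<Rightarrow> int \<Rightarrow> 'a \<Rightarrow> real" where
  "ema \<alpha> X t \<omega> = sqrt (1 - \<alpha>\<^sup>2) * (\<Sum>j. \<alpha> ^ j * X (t - int j) \<omega>)"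

lemma ema_0: "ema 0 X = X"
proof -
  have "(\<Sum>j. (0::real) ^ j * X (t - int j) \<omega>) = X t \<omega>" for t \<omega>
    by (subst suminf_finite[where N = "{0}"]) auto
  then show ?thesis by (simp add: ema_def fun_eq_iff)
qed

(* The rule determines W only where some s \<le> t has \<bar>S s \<omega>\<bar> \<ge> \<eta>. Off that almost sure
   event W is unconstrained apart from measurability, so the rule is required almost surely. *)
definition threshold_portfolio ::
  "'a measure \<Rightarrow> real \<Rightarrow> (int \<Rightarrow> 'a \<Rightarrow> real) \<Rightarrow> (int \<Rightarrow> 'a \<Rightarrow> real) \<Rightarrow> bool" where
  "threshold_portfolio M \<eta> S W \<longleftrightarrow>
     (\<forall>t. W t \<in> borel_measurable M) \<and>
     (AE \<omega> in M. \<forall>t.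
        W t \<omega> \<in> {-1, 1} \<and>
        (S t \<omega> \<ge> \<eta> \<longrightarrow> W t \<omega> = 1) \<and>
        (S t \<omega> \<le> - \<eta> \<longrightarrow> W t \<omega> = -1) \<and>
        (- \<eta> < S t \<omega> \<and> S t \<omega> < \<eta> \<longrightarrow> W t \<omega> = W (t - 1) \<omega>))"

lemma threshold_portfolio_exists:
  assumes [measurable]: "\<And>t. S t \<in> borel_measurable M" and "\<eta> > 0"
  shows "\<exists>W. threshold_portfolio M \<eta> S W"
proof -
  define P where "P t \<omega> \<longleftrightarrow> (\<exists>n. S (t - int n) \<omega> \<le> - \<eta> \<and> (\<forall>m<n. - \<eta> < S (t - int m) \<omega> \<and> S (t - int m) \<omega> < \<eta>))" for t \<omega>
  define W where "W t \<omega> = (if P t \<omega> then -1 else 1 :: real)" for t \<omega>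
  have m: "W t \<in> borel_measurable M" for t
    unfolding W_def P_def by measurable
  have low: "P t \<omega>" if "S t \<omega> \<le> - \<eta>" for t \<omega>
    unfolding P_def using that by (intro exI[of _ 0]) auto
  have high: "\<not> P t \<omega>" if "S t \<omega> \<ge> \<eta>" for t \<omega>
  proof
    assume "P t \<omega>"
    then obtain n where n: "S (t - int n) \<omega> \<le> - \<eta>" "\<forall>m<n. S (t - int m) \<omega> < \<eta>"
      unfolding P_def by blast
    with that \<open>\<eta> > 0\<close> show False by (cases n) force+
  qed
  have mid: "P t \<omega> \<longleftrightarrow> P (t - 1) \<omega>" if h: "- \<eta> < S t \<omega>" "S t \<omega> < \<eta>" for t \<omega>
  proof
    assume "P t \<omega>"
    then obtain n where n: "S (t - int n) \<omega> \<le> - \<eta>"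
      "\<forall>m<n. - \<eta> < S (t - int m) \<omega> \<and> S (t - int m) \<omega> < \<eta>"
      unfolding P_def by blast
    with h obtain k where k: "n = Suc k" by (cases n) auto
    have "- \<eta> < S (t - 1 - int m) \<omega> \<and> S (t - 1 - int m) \<omega> < \<eta>" if "m < k" for m
      using n(2)[rule_format, of "Suc m"] that k by (simp add: algebra_simps)
    then show "P (t - 1) \<omega>"
      unfolding P_def using n(1) k by (intro exI[of _ k]) (simp add: algebra_simps)
  next
    assume "P (t - 1) \<omega>"
    then obtain n where n: "S (t - 1 - int n) \<omega> \<le> - \<eta>"
      "\<forall>m<n. - \<eta> < S (t - 1 - int m) \<omega> \<and> S (t - 1 - int m) \<omega> < \<eta>"
      unfolding P_def by blast
    have "- \<eta> < S (t - int m) \<omega> \<and> S (t - int m) \<omega> < \<eta>" if "m < Suc n" for m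
      using n(2)[rule_format, of "m - 1"] that h by (cases m) (auto simp: algebra_simps)
    then show "P t \<omega>"
      unfolding P_def using n(1) by (intro exI[of _ "Suc n"]) (simp add: algebra_simps)
  qed
  have "threshold_portfolio M \<eta> S W"
    unfolding threshold_portfolio_def using m low high mid by (auto simp: W_def)
  then show ?thesis by blast
qed

definition target_portfolio_corr ::
  "'a measure \<Rightarrow> (int \<Rightarrow> 'a \<Rightarrow> real) \<Rightarrow> (int \<Rightarrow> 'a \<Rightarrow> real) \<Rightarrow> int \<Rightarrow> real" where
  "target_portfolio_corr M W Y t = (\<integral>\<omega>. W t \<omega> * Y t \<omega> \<partial>M)"

definition improvement_bound :: "real \<Rightarrow> real \<Rightarrow> real" where
  "improvement_bound \<alpha> \<eta> =
     (1 - sqrt (1 - \<alpha>\<^sup>2)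
        + sqrt (1 - \<alpha>\<^sup>2) * std_normal_cdf (sqrt ((1 + \<alpha>) / (1 - \<alpha>)) * \<eta>)
        - sqrt (1 - \<alpha>\<^sup>2) * std_normal_cdf (sqrt ((1 - \<alpha>) / (1 + \<alpha>)) * \<eta>)) /
     (sqrt (1 - \<alpha>\<^sup>2)
        - sqrt (1 - \<alpha>\<^sup>2) * std_normal_cdf (sqrt ((1 + \<alpha>) / (1 - \<alpha>)) * \<eta>)
        + sqrt (1 - \<alpha>\<^sup>2) * std_normal_cdf (sqrt ((1 - \<alpha>) / (1 + \<alpha>)) * \<eta>))"

end

theory Submission
  imports Defs
begin

text \<open>
Write \<open>\<phi>\<close> for the standard Gaussian density, \<open>S\<close> for the smoothed signal, \<open>c = sqrt (1 - \<alpha>\<^sup>2)\<close> and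
\<open>q s = \<phi> ((\<eta> + \<alpha> * s) / c)\<close>. The signal is a stationary AR(1) process,
\<open>S t = \<alpha> * S (t - 1) + c * X t\<close> with standard Gaussian marginals, and the innovation \<open>X t\<close> is
independent of \<open>(W (t - 1), S (t - 1))\<close>. The noise \<open>\<epsilon>\<close> is independent of the portfolio, so only
the mean of \<open>W t * X t\<close> matters. Averaging over \<open>X t\<close> alone, given \<open>S (t - 1) = s\<close> and
\<open>W (t - 1) = v\<close>, gives \<open>q s + q (- s) - v * (q (- s) - q s)\<close> (lemma \<open>corr_step\<close>).

For the raw signal \<open>\<alpha> = 0\<close> the function \<open>q\<close> is constant and the mean is exactly \<open>2 * \<phi> \<eta>\<close>.
For \<open>\<alpha> > 0\<close> everything depends on the sign of \<open>v * s\<close>. Where \<open>\<bar>s\<bar> \<ge> \<eta>\<close>, the position \<open>v\<close> is the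
sign of \<open>s\<close>. Inside the band \<open>\<bar>s\<bar> < \<eta>\<close> it is a remembered sign. Were that remembered sign a
fair coin independent of \<open>s\<close>, the mean would be \<open>2 * \<phi> \<eta> * D\<close> with \<open>D = coin_flip_ratio \<alpha> \<eta>\<close>
(lemma \<open>coin_flip_integral\<close>), and the bound of the theorem is precisely \<open>(1 - D) / D\<close>.
In reality the remembered sign is positively associated with \<open>s\<close>, because the signal is
positively autocorrelated. As \<open>q (- s) > q s\<close> for \<open>s > 0\<close>, agreement of the two signs lowers the
mean strictly below the coin value. Together with \<open>0 < D < 1\<close> this yields both claims.

The association is shown by running the recursion backwards. If \<open>h\<close> is odd and nonnegative on
the positive half-line, then the mean of \<open>W t * h (S t)\<close> is the mean of \<open>\<bar>h (S t)\<bar>\<close> outside the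
band plus the mean of \<open>W (t - 1) * k (S (t - 1))\<close>, where \<open>k\<close> arises by averaging the inner part of
\<open>h\<close> over one step of the signal (lemma \<open>association_step\<close>). By symmetry of the Gaussian, \<open>k\<close> is
again odd and nonnegative on the positive half-line, so iterating only adds nonnegative terms.

The portfolio is only prescribed almost surely and has no starting point. The recursion is
therefore carried out for the rule with memory of finite length \<open>n\<close> (\<open>recent_sign\<close>), whose
value is 0 when no crossing of the threshold is seen. This version is a function of finitely
many past signal values, and it tends to the portfolio as \<open>n\<close> grows, because almost surely the
signal has left the band at some past time (lemma \<open>AE_signal_exceeds\<close>). All strict
inequalities hold with a margin that does not depend on \<open>n\<close>, so they survive the limit.
\<close>

section \<open>Integrals against the standard Gaussian\<close>


lemma std_normal_density_even: "std_normal_density (- x) = std_normal_density x"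
  by (simp add: std_normal_density_def)

lemma integral_std_normal:
  fixes f :: "real \<Rightarrow> real"
  assumes [measurable]: "f \<in> borel_measurable borel"
  shows "(\<integral>x. f x \<partial>std_normal_distribution) = (\<integral>x. std_normal_density x * f x \<partial>lborel)"
  by (subst integral_real_density) auto

lemma integrable_std_normal_bounded:
  fixes f :: "real \<Rightarrow> real"
  assumes [measurable]: "f \<in> borel_measurable borel" and "\<And>x. \<bar>f x\<bar> \<le> B"
  shows "integrable std_normal_distribution f"
proof -
  interpret real_distribution std_normal_distribution by (rule real_dist_normal_dist)
  show ?thesis
    by (rule integrable_const_bound[where B = B]) (use assms in auto)
qed

lemma lborel_integral_pos:
  fixes f :: "real \<Rightarrow> real"
  assumes f: "integrable lborel f" and nonneg: "\<And>x. 0 \<le> f x"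
    and "a < b" and pos: "\<And>x. a < x \<Longrightarrow> x < b \<Longrightarrow> 0 < f x"
  shows "0 < (\<integral>x. f x \<partial>lborel)"
proof (rule ccontr)
  assume "\<not> ?thesis"
  moreover have "0 \<le> (\<integral>x. f x \<partial>lborel)"
    using nonneg by (rule Bochner_Integration.integral_nonneg)
  ultimately have "(\<integral>x. f x \<partial>lborel) = 0" by linarith
  then have "AE x in lborel. f x = 0"
    using integral_nonneg_eq_0_iff_AE[OF f] nonneg by simp
  then have "AE x in lborel. x \<notin> {a<..<b}"
    by eventually_elim (use pos in force)
  then have "emeasure lborel {a<..<b} = 0"
    by (subst (asm) AE_iff_measurable[of "{a<..<b}"]) auto
  with \<open>a < b\<close> show False by simp
qed

lemma std_normal_integral_pos:
  fixes f :: "real \<Rightarrow> real"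
  assumes f: "integrable std_normal_distribution f" and nonneg: "\<And>x. 0 \<le> f x"
    and "a < b" and pos: "\<And>x. a < x \<Longrightarrow> x < b \<Longrightarrow> 0 < f x"
  shows "0 < (\<integral>x. f x \<partial>std_normal_distribution)"
proof -
  have [measurable]: "f \<in> borel_measurable borel"
    using borel_measurable_integrable[OF f] by simp
  show ?thesis
    unfolding integral_std_normal[OF \<open>f \<in> borel_measurable borel\<close>]
    using f by (intro lborel_integral_pos[where a = a and b = b])
      (auto simp: integrable_real_density nonneg pos normal_density_pos \<open>a < b\<close>)
qed

lemma std_normal_integral_reflect:
  fixes f :: "real \<Rightarrow> real"
  assumes [measurable]: "f \<in> borel_measurable borel"
  shows "(\<integral>x. f (- x) \<partial>std_normal_distribution) = (\<integral>x. f x \<partial>std_normal_distribution)"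
  using lborel_integral_real_affine[of "-1" "\<lambda>x. std_normal_density x * f x" 0]
  by (simp add: integral_std_normal std_normal_density_even)

text \<open>
The function \<open>z * \<phi> z\<close> has the antiderivative \<open>- \<phi> z\<close>.
\<close>

lemma std_normal_tail_mean:
  "(\<integral>z. z * indicator {a..} z \<partial>std_normal_distribution) = std_normal_density a"
proof -
  have int: "set_integrable lborel {a<..} (\<lambda>z. std_normal_density z * z)"
    unfolding set_integrable_def
    using integrable_std_normal_moment[of 1] by (intro integrable_mult_indicator) auto
  have lim: "((\<lambda>z. - std_normal_density z) \<longlongrightarrow> 0) at_top"
    unfolding std_normal_density_def by real_asymp
  have "(LBINT z=ereal a..\<infinity>. std_normal_density z * z) = 0 - (- std_normal_density a)"
  proof (rule interval_integral_FTC_integrable[where F = "\<lambda>z. - std_normal_density z"])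
    show "((\<lambda>z. - std_normal_density z) has_vector_derivative std_normal_density x * x) (at x)" for x
    proof -
      obtain K :: real where K: "std_normal_density x = K * exp (- x\<^sup>2 / 2)" for x
        unfolding std_normal_density_def by blast
      show ?thesis
        unfolding K has_real_derivative_iff_has_vector_derivative[symmetric]
        by (auto intro!: derivative_eq_intros simp: power2_eq_square)
    qed
    show "isCont (\<lambda>z. std_normal_density z * z) x" for x
      unfolding std_normal_density_def by (intro continuous_intros) auto
    show "(((\<lambda>z. - std_normal_density z) \<circ> real_of_ereal) \<longlongrightarrow> 0) (at_left \<infinity>)"
      using lim by (simp add: ereal_tendsto_simps)
    have "((\<lambda>z. - std_normal_density z) \<longlongrightarrow> - std_normal_density a) (at_right a)"
      unfolding std_normal_density_def by (intro tendsto_intros) auto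
    then show "(((\<lambda>z. - std_normal_density z) \<circ> real_of_ereal) \<longlongrightarrow> - std_normal_density a) (at_right (ereal a))"
      by (simp add: ereal_tendsto_simps)
  qed (use int in auto)
  then have "(\<integral>z. indicator {a<..} z *\<^sub>R (std_normal_density z * z) \<partial>lborel) = std_normal_density a"
    by (simp add: interval_integral_to_infinity_eq set_lebesgue_integral_def)
  also have "(\<integral>z. indicator {a<..} z *\<^sub>R (std_normal_density z * z) \<partial>lborel)
      = (\<integral>z. std_normal_density z * (z * indicator {a..} z) \<partial>lborel)"
    by (rule integral_cong_AE) (auto intro!: AE_I[of _ _ "{a}"] split: split_indicator)
  finally show ?thesis by (subst integral_std_normal) auto
qed

lemma std_normal_cdf_integral:
  "(\<integral>z. indicator {..x} z \<partial>std_normal_distribution) = std_normal_cdf x"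
  by (simp add: cdf_def)

lemma AE_std_normal_neq: "AE z in std_normal_distribution. z \<noteq> x"
  by (subst AE_density) (auto intro!: AE_I[of _ _ "{x}"])

lemma std_normal_cdf_minus: "std_normal_cdf (- x) = 1 - std_normal_cdf x"
proof -
  interpret real_distribution std_normal_distribution by (rule real_dist_normal_dist)
  have "std_normal_cdf (- x) = (\<integral>z. indicator {..- x} (- z) \<partial>std_normal_distribution)"
    unfolding std_normal_cdf_integral[symmetric] by (rule std_normal_integral_reflect[symmetric]) auto
  also have "\<dots> = (\<integral>z. 1 - indicator {..x} z \<partial>std_normal_distribution)"
    by (rule integral_cong_AE) (use AE_std_normal_neq[of x] in \<open>auto elim!: eventually_mono split: split_indicator\<close>)
  also have "\<dots> = 1 - std_normal_cdf x"
    by (subst Bochner_Integration.integral_diff) (auto simp: cdf_def prob_space[simplified] less_top[symmetric])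
  finally show ?thesis .
qed

text \<open>
The joint density of \<open>S\<close> and \<open>\<alpha> * S + c * Z\<close> is symmetric in its two arguments. Evaluated at
\<open>s\<close> and \<open>- \<eta>\<close> this reads \<open>\<phi> s * \<phi> ((\<eta> + \<alpha> * s) / c) = \<phi> \<eta> * \<phi> ((s + \<alpha> * \<eta>) / c)\<close>; hence the weight
acts as a shift of the mean and a change of scale.
\<close>

lemma std_normal_tilt:
  fixes f :: "real \<Rightarrow> real"
  assumes "0 \<le> \<alpha>" "\<alpha> < 1" and [measurable]: "f \<in> borel_measurable borel"
  defines "c \<equiv> sqrt (1 - \<alpha>\<^sup>2)"
  shows "(\<integral>s. std_normal_density ((\<eta> + \<alpha> * s) / c) * f s \<partial>std_normal_distribution)
    = c * std_normal_density \<eta> * (\<integral>z. f (c * z - \<alpha> * \<eta>) \<partial>std_normal_distribution)"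
proof -
  have a: "\<alpha>\<^sup>2 < 1" using assms by (simp add: abs_square_less_1)
  have c: "c > 0" "c\<^sup>2 = 1 - \<alpha>\<^sup>2" using a by (auto simp: c_def)
  \<comment> \<open>The map \<open>(\<eta>, z) \<mapsto> (c * z - \<alpha> * \<eta>, c * \<eta> + \<alpha> * z)\<close> is orthogonal, so it preserves \<open>\<eta>\<^sup>2 + z\<^sup>2\<close>.\<close>
  have eq: "std_normal_density (c * z - \<alpha> * \<eta>) * std_normal_density ((\<eta> + \<alpha> * (c * z - \<alpha> * \<eta>)) / c)
      = std_normal_density \<eta> * std_normal_density z" for z
  proof -
    have "\<eta> + \<alpha> * (c * z - \<alpha> * \<eta>) = (1 - \<alpha>\<^sup>2) * \<eta> + \<alpha> * c * z"
      by (simp add: algebra_simps power2_eq_square)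
    also have "\<dots> = c * (c * \<eta> + \<alpha> * z)"
      unfolding c(2)[symmetric] by (simp add: algebra_simps power2_eq_square)
    finally have *: "(\<eta> + \<alpha> * (c * z - \<alpha> * \<eta>)) / c = c * \<eta> + \<alpha> * z" using c by simp
    have "(c * z - \<alpha> * \<eta>)\<^sup>2 + (c * \<eta> + \<alpha> * z)\<^sup>2 = (c\<^sup>2 + \<alpha>\<^sup>2) * (\<eta>\<^sup>2 + z\<^sup>2)"
      by (simp add: algebra_simps power2_eq_square)
    then have "(c * z - \<alpha> * \<eta>)\<^sup>2 + (c * \<eta> + \<alpha> * z)\<^sup>2 = \<eta>\<^sup>2 + z\<^sup>2" using c by simp
    then show ?thesis
      unfolding * std_normal_density_def
      by (simp add: exp_add[symmetric] add_divide_distrib[symmetric] minus_add_distrib[symmetric]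
          del: minus_add_distrib)
  qed
  have "(\<integral>s. std_normal_density ((\<eta> + \<alpha> * s) / c) * f s \<partial>std_normal_distribution)
     = (\<integral>s. std_normal_density s * (std_normal_density ((\<eta> + \<alpha> * s) / c) * f s) \<partial>lborel)"
    by (rule integral_std_normal) measurable
  also have "\<dots> = c * (\<integral>z. std_normal_density (c * z - \<alpha> * \<eta>) *
      (std_normal_density ((\<eta> + \<alpha> * (c * z - \<alpha> * \<eta>)) / c) * f (c * z - \<alpha> * \<eta>)) \<partial>lborel)"
    using c by (subst lborel_integral_real_affine[where c = c and t = "- \<alpha> * \<eta>"]) (simp_all add: algebra_simps)
  also have "\<dots> = c * (\<integral>z. std_normal_density \<eta> * (std_normal_density z * f (c * z - \<alpha> * \<eta>)) \<partial>lborel)"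
    by (simp only: mult.assoc[symmetric] eq)
  also have "\<dots> = c * std_normal_density \<eta> * (\<integral>z. f (c * z - \<alpha> * \<eta>) \<partial>std_normal_distribution)"
    by (subst integral_std_normal) auto
  finally show ?thesis .
qed

lemma std_normal_density_mono: "a\<^sup>2 \<le> b\<^sup>2 \<Longrightarrow> std_normal_density b \<le> std_normal_density a"
  by (simp add: std_normal_density_def divide_right_mono)

lemma std_normal_density_strict_mono: "a\<^sup>2 < b\<^sup>2 \<Longrightarrow> std_normal_density b < std_normal_density a"
  by (simp add: std_normal_density_def divide_strict_right_mono)

lemma std_normal_density_le_1: "std_normal_density x \<le> 1"
proof -
  have "1 \<le> sqrt (2 * pi)" using pi_gt3 by simp
  moreover have "exp (- x\<^sup>2 / 2) \<le> 1" by simp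
  ultimately show ?thesis unfolding std_normal_density_def
    by (simp add: divide_simps order_trans[OF _ \<open>1 \<le> sqrt (2 * pi)\<close>])
qed

text \<open>
This is the denominator of \<open>improvement_bound\<close>, whose numerator is 1 minus the same quantity.
\<close>

definition coin_flip_ratio :: "real \<Rightarrow> real \<Rightarrow> real" where
  "coin_flip_ratio \<alpha> \<eta> = sqrt (1 - \<alpha>\<^sup>2) * (1 - std_normal_cdf (sqrt ((1 + \<alpha>) / (1 - \<alpha>)) * \<eta>)
     + std_normal_cdf (sqrt ((1 - \<alpha>) / (1 + \<alpha>)) * \<eta>))"

text \<open>
The mean of \<open>W t * X t\<close> when the position inside the band is an independent fair coin: there the
two values \<open>2 * q s\<close> and \<open>2 * q (- s)\<close> are averaged, whereas outside the band the position agrees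
with the sign of the signal and the value is \<open>2 * q \<bar>s\<bar>\<close>. By reflection the integral is twice
the integral of \<open>q\<close> against a step function, which the tilting identity turns into values of the
distribution function.
\<close>

lemma coin_flip_integral:
  assumes \<alpha>: "0 \<le> \<alpha>" "\<alpha> < 1" and "0 < \<eta>"
  defines "c \<equiv> sqrt (1 - \<alpha>\<^sup>2)"
  defines "q \<equiv> \<lambda>s. std_normal_density ((\<eta> + \<alpha> * s) / c)"
  shows "(\<integral>s. (q s + q (- s)) - \<bar>q (- s) - q s\<bar> * indicator {s. \<eta> \<le> \<bar>s\<bar>} s \<partial>std_normal_distribution)
     = 2 * std_normal_density \<eta> * coin_flip_ratio \<alpha> \<eta>"
proof -
  interpret real_distribution std_normal_distribution by (rule real_dist_normal_dist)
  have "\<alpha>\<^sup>2 < 1" using \<alpha> by (simp add: abs_square_less_1)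
  then have c: "c > 0" "c = sqrt (1 - \<alpha>) * sqrt (1 + \<alpha>)"
    by (auto simp: c_def real_sqrt_mult[symmetric] algebra_simps power2_eq_square)
  \<comment> \<open>The affine map \<open>z \<mapsto> c * z - \<alpha> * \<eta>\<close> sends the interval from \<open>- p\<close> to \<open>r\<close> onto the band.\<close>
  define r p where "r = (1 + \<alpha>) * \<eta> / c" and "p = (1 - \<alpha>) * \<eta> / c"
  have r: "r = sqrt ((1 + \<alpha>) / (1 - \<alpha>)) * \<eta>"
    using \<alpha> real_sqrt_mult_self[of "1 + \<alpha>"] by (simp add: r_def c(2) real_sqrt_divide field_simps)
  have p: "p = sqrt ((1 - \<alpha>) / (1 + \<alpha>)) * \<eta>"
    using \<alpha> real_sqrt_mult_self[of "1 - \<alpha>"]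
    by (simp add: p_def c(2) real_sqrt_divide divide_simps mult.assoc[symmetric])
  have pr: "- p < r" using \<alpha> \<open>0 < \<eta>\<close> c by (simp add: r_def p_def field_simps)
  have [measurable]: "q \<in> borel_measurable borel" unfolding q_def by measurable
  have q: "0 \<le> q s" "\<bar>q s\<bar> \<le> 1" for s
    using std_normal_density_le_1 by (auto simp: q_def)
  \<comment> \<open>The step function for which \<open>q s * f s + q (- s) * f (- s)\<close> is the integrand: weight 1 on each sign in the band, weight 2 on the agreeing sign outside.\<close>
  define f :: "real \<Rightarrow> real" where "f s = indicator {- \<eta> <..< \<eta>} s + 2 * indicator {\<eta>..} s" for s
  have [measurable]: "f \<in> borel_measurable borel" unfolding f_def by measurable
  have f: "\<bar>f s\<bar> \<le> 2" for s by (auto simp: f_def split: split_indicator)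
  have le: "q s \<le> q (- s)" if "0 \<le> s" for s
  proof -
    have "0 \<le> \<alpha> * s" using \<alpha> that by simp
    then have "(\<eta> + \<alpha> * - s)\<^sup>2 \<le> (\<eta> + \<alpha> * s)\<^sup>2"
      using \<open>0 < \<eta>\<close> by (simp add: power2_diff power2_sum)
    then show ?thesis unfolding q_def using c
      by (intro std_normal_density_mono) (simp add: power_divide divide_right_mono)
  qed
  have "(q s + q (- s)) - \<bar>q (- s) - q s\<bar> * indicator {s. \<eta> \<le> \<bar>s\<bar>} s = q s * f s + q (- s) * f (- s)" for s
    using le[of s] le[of "- s"] \<open>0 < \<eta>\<close>
    by (cases "s \<ge> \<eta>"; cases "s \<le> - \<eta>") (auto simp: f_def indicator_def)
  then have "(\<integral>s. (q s + q (- s)) - \<bar>q (- s) - q s\<bar> * indicator {s. \<eta> \<le> \<bar>s\<bar>} s \<partial>std_normal_distribution)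
     = (\<integral>s. q s * f s + q (- s) * f (- s) \<partial>std_normal_distribution)" by simp
  also have "\<dots> = (\<integral>s. q s * f s \<partial>std_normal_distribution) + (\<integral>s. q (- s) * f (- s) \<partial>std_normal_distribution)"
    using q f by (intro Bochner_Integration.integral_add integrable_std_normal_bounded[where B = "1 * 2"])
      (auto simp only: abs_mult intro!: mult_mono, auto)
  also have "(\<integral>s. q (- s) * f (- s) \<partial>std_normal_distribution) = (\<integral>s. q s * f s \<partial>std_normal_distribution)"
    by (rule std_normal_integral_reflect[where f = "\<lambda>s. q s * f s"]) measurable
  also have "(\<integral>s. q s * f s \<partial>std_normal_distribution) = c * std_normal_density \<eta> * (\<integral>z. f (c * z - \<alpha> * \<eta>) \<partial>std_normal_distribution)"
    unfolding q_def c_def by (intro std_normal_tilt \<alpha>) measurable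
  also have "(\<integral>z. f (c * z - \<alpha> * \<eta>) \<partial>std_normal_distribution)
     = (\<integral>z. (2 - indicator {..r} z) - indicator {..- p} z \<partial>std_normal_distribution)"
  proof (rule integral_cong_AE)
    have 1: "c * z - \<alpha> * \<eta> < \<eta> \<longleftrightarrow> z < r" "- \<eta> < c * z - \<alpha> * \<eta> \<longleftrightarrow> - p < z" for z
      using c by (auto simp: r_def p_def field_simps)
    show "AE z in std_normal_distribution. f (c * z - \<alpha> * \<eta>) = (2 - indicator {..r} z) - indicator {..- p} z"
      using AE_std_normal_neq[of r]
      by eventually_elim (use pr in \<open>auto simp: f_def indicator_def 1 not_less[symmetric]\<close>)
  qed measurable
  also have "\<dots> = 2 - std_normal_cdf r - std_normal_cdf (- p)"
    by (subst Bochner_Integration.integral_diff, simp_all add: less_top[symmetric])+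
      (simp add: cdf_def prob_space[simplified])
  also have "\<dots> = 1 - std_normal_cdf r + std_normal_cdf p"
    by (simp add: std_normal_cdf_minus)
  finally show ?thesis unfolding r p coin_flip_ratio_def c_def by simp
qed

lemma coin_flip_ratio_less_1:
  assumes "0 < \<alpha>" "\<alpha> < 1" "0 < \<eta>"
  shows "coin_flip_ratio \<alpha> \<eta> < 1"
proof -
  interpret real_distribution std_normal_distribution by (rule real_dist_normal_dist)
  have "sqrt ((1 - \<alpha>) / (1 + \<alpha>)) * \<eta> \<le> sqrt ((1 + \<alpha>) / (1 - \<alpha>)) * \<eta>"
    using assms by (intro mult_right_mono real_sqrt_le_mono) (auto simp: divide_simps power2_eq_square algebra_simps)
  from cdf_nondecreasing[OF this] have "coin_flip_ratio \<alpha> \<eta> \<le> sqrt (1 - \<alpha>\<^sup>2) * 1"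
    unfolding coin_flip_ratio_def using assms by (intro mult_left_mono) (auto simp: power_le_one_iff)
  moreover have "sqrt (1 - \<alpha>\<^sup>2) < 1" using assms by simp
  ultimately show ?thesis by linarith
qed

section \<open>The Gaussian autoregressive kernel on odd functions\<close>

text \<open>
The one-step transition operator of the AR(1) signal.
\<close>

definition ema_transition :: "real \<Rightarrow> (real \<Rightarrow> real) \<Rightarrow> real \<Rightarrow> real" where
  "ema_transition \<alpha> h s = (\<integral>z. h (\<alpha> * s + sqrt (1 - \<alpha>\<^sup>2) * z) \<partial>std_normal_distribution)"

lemma measurable_ema_transition [measurable]:
  assumes [measurable]: "h \<in> borel_measurable borel"
  shows "ema_transition \<alpha> h \<in> borel_measurable borel"
proof -
  interpret real_distribution std_normal_distribution by (rule real_dist_normal_dist)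
  show ?thesis unfolding ema_transition_def[abs_def] by measurable
qed

lemma ema_transition_bounded:
  assumes [measurable]: "h \<in> borel_measurable borel" and B: "\<And>x. \<bar>h x\<bar> \<le> B"
  shows "\<bar>ema_transition \<alpha> h s\<bar> \<le> B"
proof -
  interpret real_distribution std_normal_distribution by (rule real_dist_normal_dist)
  have "\<bar>ema_transition \<alpha> h s\<bar> \<le> (\<integral>z. \<bar>h (\<alpha> * s + sqrt (1 - \<alpha>\<^sup>2) * z)\<bar> \<partial>std_normal_distribution)"
    unfolding ema_transition_def by (rule integral_abs_bound)
  also have "\<dots> \<le> B"
    by (rule integral_le_const[OF integrable_std_normal_bounded]) (use B in auto)
  finally show ?thesis .
qed

lemma ema_transition_odd:
  assumes [measurable]: "h \<in> borel_measurable borel" and odd: "\<And>x. h (- x) = - h x"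
  shows "ema_transition \<alpha> h (- s) = - ema_transition \<alpha> h s"
proof -
  let ?c = "sqrt (1 - \<alpha>\<^sup>2)"
  have "ema_transition \<alpha> h (- s) = (\<integral>z. h (\<alpha> * - s + ?c * - z) \<partial>std_normal_distribution)"
    unfolding ema_transition_def
    by (rule std_normal_integral_reflect[symmetric]) measurable
  also have "\<dots> = (\<integral>z. - h (\<alpha> * s + ?c * z) \<partial>std_normal_distribution)"
    by (simp add: odd[symmetric] algebra_simps)
  finally show ?thesis by (simp add: ema_transition_def)
qed

text \<open>
The mean of an odd \<open>h\<close> after one step from \<open>s\<close> is the negative of its mean after one step from
\<open>- s\<close>. Averaging the two expressions exhibits the transition operator on odd functions as an
integral operator whose kernel has the sign of \<open>y * s\<close>.
\<close>

lemma ema_transition_antisym: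
  assumes \<alpha>: "0 \<le> \<alpha>" "\<alpha> < 1" and [measurable]: "h \<in> borel_measurable borel"
    and odd: "\<And>x. h (- x) = - h x" and B: "\<And>x. \<bar>h x\<bar> \<le> B"
  defines "c \<equiv> sqrt (1 - \<alpha>\<^sup>2)"
  defines "k \<equiv> \<lambda>s y. (std_normal_density ((y - \<alpha> * s) / c) - std_normal_density ((y + \<alpha> * s) / c)) * h y"
  shows "integrable lborel (k s)" "2 * c * ema_transition \<alpha> h s = (\<integral>y. k s y \<partial>lborel)"
proof -
  have "\<alpha>\<^sup>2 < 1" using \<alpha> by (simp add: abs_square_less_1)
  then have c: "c > 0" by (simp add: c_def)
  have int: "integrable lborel (\<lambda>y. std_normal_density ((y + m) / c) * h y)" for m
  proof (rule Bochner_Integration.integrable_bound)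
    have "integrable lborel (\<lambda>y. std_normal_density (m / c + (1 / c) * y))"
      using c by (intro lborel_integrable_real_affine) auto
    then show "integrable lborel (\<lambda>y. B * std_normal_density ((y + m) / c))"
      by (simp add: add_divide_distrib add.commute)
    have "0 \<le> B" using B[of 0] by simp
    then show "AE y in lborel. norm (std_normal_density ((y + m) / c) * h y) \<le> norm (B * std_normal_density ((y + m) / c))"
      using B by (auto simp: abs_mult mult.commute[of B] intro!: mult_left_mono)
  qed measurable
  have shift: "c * ema_transition \<alpha> h m = (\<integral>y. std_normal_density ((y + - (\<alpha> * m)) / c) * h y \<partial>lborel)" for m
    unfolding ema_transition_def c_def[symmetric] using c
    by (subst integral_std_normal, measurable, subst (2) lborel_integral_real_affine[where c = c and t = "\<alpha> * m"])
      (simp_all add: algebra_simps)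
  have 1: "c * ema_transition \<alpha> h s = (\<integral>y. std_normal_density ((y - \<alpha> * s) / c) * h y \<partial>lborel)"
    using shift[of s] by simp
  have 2: "- (c * ema_transition \<alpha> h s) = (\<integral>y. std_normal_density ((y + \<alpha> * s) / c) * h y \<partial>lborel)"
    using shift[of "- s"] by (simp add: ema_transition_odd odd)
  show "integrable lborel (k s)"
    unfolding k_def using Bochner_Integration.integrable_diff[OF int[of "- (\<alpha> * s)"] int[of "\<alpha> * s"]]
    by (simp add: algebra_simps)
  have "(\<integral>y. k s y \<partial>lborel) = (\<integral>y. std_normal_density ((y - \<alpha> * s) / c) * h y - std_normal_density ((y + \<alpha> * s) / c) * h y \<partial>lborel)"
    by (simp add: k_def algebra_simps)
  also have "\<dots> = 2 * c * ema_transition \<alpha> h s"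
    using int[of "- (\<alpha> * s)"] int[of "\<alpha> * s"] 1 2 by (simp add: Bochner_Integration.integral_diff)
  finally show "2 * c * ema_transition \<alpha> h s = (\<integral>y. k s y \<partial>lborel)" ..
qed

text \<open>
For \<open>y\<close> and \<open>s\<close> of the same sign, \<open>y\<close> lies closer to \<open>\<alpha> * s\<close> than to \<open>- \<alpha> * s\<close>, so the first density
is at least the second; for opposite signs it is at most the second, and \<open>h y\<close> changes sign as well.
\<close>

lemma ema_kernel_sgn:
  fixes h :: "real \<Rightarrow> real"
  assumes "0 \<le> \<alpha>" "0 \<le> s" "c > 0" and odd: "\<And>x. h (- x) = - h x" and nonneg: "\<And>x. 0 \<le> x \<Longrightarrow> 0 \<le> h x"
  shows "0 \<le> (std_normal_density ((y - \<alpha> * s) / c) - std_normal_density ((y + \<alpha> * s) / c)) * h y"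
proof -
  have m: "0 \<le> \<alpha> * s" using assms by simp
  show ?thesis
  proof (cases "0 \<le> y")
    case True
    then have "0 \<le> y * (\<alpha> * s)" using m by simp
    then have "((y - \<alpha> * s) / c)\<^sup>2 \<le> ((y + \<alpha> * s) / c)\<^sup>2"
      unfolding power_divide by (intro divide_right_mono) (simp_all add: power2_diff power2_sum ac_simps)
    then show ?thesis using nonneg[OF True] std_normal_density_mono by simp
  next
    case False
    then have "y * (\<alpha> * s) \<le> 0" using m by (simp add: mult_nonpos_nonneg)
    then have "((y + \<alpha> * s) / c)\<^sup>2 \<le> ((y - \<alpha> * s) / c)\<^sup>2"
      unfolding power_divide by (intro divide_right_mono) (simp_all add: power2_diff power2_sum ac_simps)
    moreover have "h y \<le> 0" using nonneg[of "- y"] False odd[of y] by simp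
    ultimately show ?thesis using std_normal_density_mono by (intro mult_nonpos_nonpos) auto
  qed
qed

lemma ema_transition_nonneg:
  assumes \<alpha>: "0 \<le> \<alpha>" "\<alpha> < 1" and "h \<in> borel_measurable borel"
    and odd: "\<And>x. h (- x) = - h x" and "\<And>x. \<bar>h x\<bar> \<le> B"
    and nonneg: "\<And>x. 0 \<le> x \<Longrightarrow> 0 \<le> h x" and "0 \<le> s"
  shows "0 \<le> ema_transition \<alpha> h s"
proof -
  have "\<alpha>\<^sup>2 < 1" using \<alpha> by (simp add: abs_square_less_1)
  then have c: "sqrt (1 - \<alpha>\<^sup>2) > 0" by simp
  have "0 \<le> 2 * sqrt (1 - \<alpha>\<^sup>2) * ema_transition \<alpha> h s"
    unfolding ema_transition_antisym(2)[OF assms(1-5)]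
    by (intro Bochner_Integration.integral_nonneg ema_kernel_sgn assms c)
  with c show ?thesis by (simp add: zero_le_mult_iff)
qed

text \<open>
Strict positivity is where \<open>\<alpha> > 0\<close> enters: the antisymmetric kernel vanishes identically at
\<open>\<alpha> = 0\<close>.
\<close>

lemma ema_transition_pos:
  assumes \<alpha>: "0 < \<alpha>" "\<alpha> < 1" and h: "h \<in> borel_measurable borel"
    and odd: "\<And>x. h (- x) = - h x" and B: "\<And>x. \<bar>h x\<bar> \<le> B"
    and nonneg: "\<And>x. 0 \<le> x \<Longrightarrow> 0 \<le> h x" and "0 < s"
    and "0 < b" and pos: "\<And>x. 0 < x \<Longrightarrow> x < b \<Longrightarrow> 0 < h x"
  shows "0 < ema_transition \<alpha> h s"
proof -
  have "\<alpha>\<^sup>2 < 1" using \<alpha> by (simp add: abs_square_less_1)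
  then have c: "sqrt (1 - \<alpha>\<^sup>2) > 0" by simp
  have m: "0 < \<alpha> * s" using assms by simp
  have "0 < 2 * sqrt (1 - \<alpha>\<^sup>2) * ema_transition \<alpha> h s"
    unfolding ema_transition_antisym(2)[OF less_imp_le[OF \<alpha>(1)] \<alpha>(2) h odd B]
  proof (rule lborel_integral_pos[OF _ _ \<open>0 < b\<close>])
    fix y assume y: "0 < y" "y < b"
    then have "0 < y * (\<alpha> * s)" using m by simp
    then have "((y - \<alpha> * s) / sqrt (1 - \<alpha>\<^sup>2))\<^sup>2 < ((y + \<alpha> * s) / sqrt (1 - \<alpha>\<^sup>2))\<^sup>2"
      unfolding power_divide using c
      by (intro divide_strict_right_mono) (simp_all add: power2_diff power2_sum ac_simps)
    then show "0 < (std_normal_density ((y - \<alpha> * s) / sqrt (1 - \<alpha>\<^sup>2)) - std_normal_density ((y + \<alpha> * s) / sqrt (1 - \<alpha>\<^sup>2))) * h y"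
      using pos[OF y] std_normal_density_strict_mono by simp
  qed (use assms c in \<open>auto intro!: ema_kernel_sgn ema_transition_antisym(1)\<close>)
  with c show ?thesis by (simp add: zero_less_mult_iff)
qed


text \<open>
The class of test functions against which the association of position and signal is measured.
It is closed under the two operations of the backward recursion, truncation to the band and the
transition operator.
\<close>

definition sign_aligned :: "(real \<Rightarrow> real) \<Rightarrow> bool" where
  "sign_aligned h \<longleftrightarrow> h \<in> borel_measurable borel \<and> (\<forall>x. h (- x) = - h x) \<and> (\<forall>x\<ge>0. 0 \<le> h x)
     \<and> (\<exists>B. \<forall>x. \<bar>h x\<bar> \<le> B)"

lemma sign_aligned_transition:
  assumes "0 \<le> \<alpha>" "\<alpha> < 1" "sign_aligned h"
  shows "sign_aligned (ema_transition \<alpha> h)"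
proof -
  obtain B where h: "h \<in> borel_measurable borel" "\<And>x. h (- x) = - h x" "\<And>x. \<bar>h x\<bar> \<le> B" "\<And>x. 0 \<le> x \<Longrightarrow> 0 \<le> h x"
    using assms unfolding sign_aligned_def by blast
  show ?thesis
    unfolding sign_aligned_def
    using measurable_ema_transition[OF h(1)] ema_transition_odd[OF h(1,2)]
      ema_transition_nonneg[OF assms(1,2) h(1-4)] ema_transition_bounded[OF h(1,3)]
    by blast
qed

definition tail_mean :: "real \<Rightarrow> (real \<Rightarrow> real) \<Rightarrow> real" where
  "tail_mean \<eta> h = (\<integral>s. \<bar>h s\<bar> * indicator {s. \<eta> \<le> \<bar>s\<bar>} s \<partial>std_normal_distribution)"

definition inner_part :: "real \<Rightarrow> (real \<Rightarrow> real) \<Rightarrow> real \<Rightarrow> real" where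
  "inner_part \<eta> h s = h s * indicator {s. \<bar>s\<bar> < \<eta>} s"

lemma sign_aligned_inner_part: "sign_aligned h \<Longrightarrow> sign_aligned (inner_part \<eta> h)"
proof -
  assume "sign_aligned h"
  then obtain B where [measurable]: "h \<in> borel_measurable borel" and h: "\<And>x. h (- x) = - h x" "\<And>x. 0 \<le> x \<Longrightarrow> 0 \<le> h x"
    and B: "\<And>x. \<bar>h x\<bar> \<le> B"
    unfolding sign_aligned_def by blast
  have "\<bar>inner_part \<eta> h x\<bar> \<le> B" for x
    using B[of x] B[THEN order_trans[OF abs_ge_zero]] by (simp add: inner_part_def indicator_def)
  moreover have "inner_part \<eta> h \<in> borel_measurable borel"
    unfolding inner_part_def[abs_def] by measurable
  ultimately show ?thesis
    using h unfolding sign_aligned_def by (intro conjI exI[of _ B]) (auto simp: inner_part_def indicator_def)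
qed

lemma tail_mean_nonneg: "0 \<le> tail_mean \<eta> h"
  unfolding tail_mean_def by (rule Bochner_Integration.integral_nonneg) auto

section \<open>The holding rule with finite memory\<close>


definition hold :: "real \<Rightarrow> real \<Rightarrow> real \<Rightarrow> real" where
  "hold \<eta> y v = (if \<eta> \<le> y then 1 else if y \<le> - \<eta> then -1 else v)"

text \<open>
The holding rule with a memory of \<open>n\<close> steps: the sign of the signal at the last time it
is outside the band among \<open>t - n + 1, \<dots>, t\<close>, and 0 if there is none. The neutral value 0 makes the
mean against every test function vanish when the memory is empty.
\<close>

primrec recent_sign :: "nat \<Rightarrow> real \<Rightarrow> (int \<Rightarrow> 'a \<Rightarrow> real) \<Rightarrow> int \<Rightarrow> 'a \<Rightarrow> real" where
  "recent_sign 0 \<eta> S t \<omega> = 0"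
| "recent_sign (Suc n) \<eta> S t \<omega> = hold \<eta> (S t \<omega>) (recent_sign n \<eta> S (t - 1) \<omega>)"

lemma abs_recent_sign_le: "\<bar>recent_sign n \<eta> S t \<omega>\<bar> \<le> 1"
  by (induction n arbitrary: t) (auto simp: hold_def)

lemma measurable_hold [measurable (raw)]:
  assumes [measurable]: "f \<in> borel_measurable M" "g \<in> borel_measurable M"
  shows "(\<lambda>x. hold \<eta> (f x) (g x)) \<in> borel_measurable M"
  unfolding hold_def by measurable

lemma measurable_recent_sign:
  assumes "\<And>s. s \<le> t \<Longrightarrow> S s \<in> borel_measurable M"
  shows "recent_sign n \<eta> S t \<in> borel_measurable M"
  using assms
proof (induction n arbitrary: t)
  case 0
  have "recent_sign 0 \<eta> S t = (\<lambda>_. 0)" by (simp add: fun_eq_iff)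
  then show ?case by simp
next
  case (Suc n)
  have [measurable]: "S t \<in> borel_measurable M" "recent_sign n \<eta> S (t - 1) \<in> borel_measurable M"
    using Suc by auto
  show ?case by (simp add: fun_eq_iff[symmetric] cong: measurable_cong)
qed

text \<open>
Only signal values up to time \<open>t\<close> matter; this is what makes the position at time \<open>t - 1\<close>
independent of the innovation at time \<open>t\<close>. The two sample points live in possibly different
spaces, since the lemma is used to pass to the coordinate process.
\<close>

lemma recent_sign_cong:
  assumes "\<And>s. s \<le> t \<Longrightarrow> S s x = S' s y"
  shows "recent_sign n \<eta> S t x = recent_sign n \<eta> S' t y"
  using assms by (induction n arbitrary: t) auto

lemma recent_sign_eq_portfolio:
  assumes "0 < \<eta>"
    and rule: "\<And>t. (S t \<omega> \<ge> \<eta> \<longrightarrow> W t \<omega> = 1) \<and> (S t \<omega> \<le> - \<eta> \<longrightarrow> W t \<omega> = -1) \<and>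
        (- \<eta> < S t \<omega> \<and> S t \<omega> < \<eta> \<longrightarrow> W t \<omega> = W (t - 1) \<omega>)"
    and "\<eta> \<le> \<bar>S (t - int j) \<omega>\<bar>" "j < n"
  shows "recent_sign n \<eta> S t \<omega> = W t \<omega>"
  using assms(3,4)
proof (induction n arbitrary: t j)
  case (Suc n)
  show ?case
  proof (cases "\<eta> \<le> \<bar>S t \<omega>\<bar>")
    case True
    then show ?thesis using rule[of t] \<open>0 < \<eta>\<close> by (auto simp: hold_def)
  next
    case False
    then obtain i where j: "j = Suc i" using Suc.prems by (cases j) auto
    have "recent_sign n \<eta> S (t - 1) \<omega> = W (t - 1) \<omega>"
      using Suc.prems by (intro Suc.IH[of _ i]) (auto simp: j algebra_simps)
    then show ?thesis using False rule[of t] by (auto simp: hold_def)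
  qed
qed simp

lemma measurable_ema:
  assumes "\<And>s. s \<le> t \<Longrightarrow> X s \<in> borel_measurable M"
  shows "ema \<alpha> X t \<in> borel_measurable M"
proof -
  have [measurable]: "X (t - int j) \<in> borel_measurable M" for j using assms by simp
  show ?thesis unfolding ema_def[abs_def] by measurable
qed

lemma ema_cong:
  assumes "\<And>s. s \<le> t \<Longrightarrow> X s x = X' s y"
  shows "ema \<alpha> X t x = ema \<alpha> X' t y"
  using assms by (simp add: ema_def)

lemma ema_rec:
  assumes "summable (\<lambda>j. \<alpha> ^ j * X (t - int j) \<omega>)" "summable (\<lambda>j. \<alpha> ^ j * X (t - 1 - int j) \<omega>)"
  shows "ema \<alpha> X t \<omega> = \<alpha> * ema \<alpha> X (t - 1) \<omega> + sqrt (1 - \<alpha>\<^sup>2) * X t \<omega>"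
proof -
  have "(\<Sum>j. \<alpha> ^ j * X (t - int j) \<omega>) = (\<Sum>j. \<alpha> ^ Suc j * X (t - int (Suc j)) \<omega>) + X t \<omega>"
    using suminf_split_head[OF assms(1)] by simp
  also have "(\<Sum>j. \<alpha> ^ Suc j * X (t - int (Suc j)) \<omega>) = (\<Sum>j. \<alpha> * (\<alpha> ^ j * X (t - 1 - int j) \<omega>))"
    by (simp add: algebra_simps)
  also have "\<dots> = \<alpha> * (\<Sum>j. \<alpha> ^ j * X (t - 1 - int j) \<omega>)"
    by (rule suminf_mult[OF assms(2)])
  finally show ?thesis by (simp add: ema_def algebra_simps)
qed

section \<open>The stationary autoregressive signal\<close>

text \<open>
An independent standard Gaussian can be integrated out first. The Gaussian variable is given as
a function of an arbitrary independent \<open>B\<close> because \<open>indep_var\<close> relates variables with values in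
the same type, here entire processes.
\<close>

lemma (in prob_space) expectation_indep_std_normal:
  fixes f :: "'b \<times> real \<Rightarrow> real"
  assumes ind: "indep_var N A L B" and g: "g \<in> borel_measurable L"
    and B: "distr M borel (\<lambda>\<omega>. g (B \<omega>)) = std_normal_distribution"
    and f: "f \<in> borel_measurable (N \<Otimes>\<^sub>M borel)" and int: "integrable M (\<lambda>\<omega>. f (A \<omega>, g (B \<omega>)))"
  shows "expectation (\<lambda>\<omega>. f (A \<omega>, g (B \<omega>)))
    = expectation (\<lambda>\<omega>. \<integral>z. f (A \<omega>, z) \<partial>std_normal_distribution)"
proof -
  interpret G: real_distribution std_normal_distribution by (rule real_dist_normal_dist)
  have [measurable]: "A \<in> measurable M N" "B \<in> measurable M L"
    using ind by (auto dest: indep_var_rv1 indep_var_rv2)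
  have [measurable]: "f \<in> borel_measurable (N \<Otimes>\<^sub>M borel)" "g \<in> borel_measurable L" by (fact f g)+
  interpret DA: prob_space "distr M N A" by (rule prob_space_distr) measurable
  interpret DB: prob_space "distr M L B" by (rule prob_space_distr) measurable
  interpret P: pair_sigma_finite "distr M N A" "distr M L B" ..
  let ?f = "\<lambda>(a, b). f (a, g b)"
  have J: "distr M N A \<Otimes>\<^sub>M distr M L B = distr M (N \<Otimes>\<^sub>M L) (\<lambda>\<omega>. (A \<omega>, B \<omega>))"
    using ind unfolding indep_var_distribution_eq by blast
  have fJ: "integrable (distr M N A \<Otimes>\<^sub>M distr M L B) ?f"
    unfolding J using int by (subst integrable_distr_eq) auto
  have "expectation (\<lambda>\<omega>. f (A \<omega>, g (B \<omega>))) = integral\<^sup>L (distr M N A \<Otimes>\<^sub>M distr M L B) ?f"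
    unfolding J by (subst integral_distr) auto
  also have "\<dots> = (\<integral>a. (\<integral>b. f (a, g b) \<partial>distr M L B) \<partial>distr M N A)"
    using P.integral_fst'[OF fJ] by simp
  also have "\<dots> = expectation (\<lambda>\<omega>. \<integral>b. f (A \<omega>, g b) \<partial>distr M L B)"
    by (subst integral_distr) measurable
  also have "\<dots> = expectation (\<lambda>\<omega>. \<integral>z. f (A \<omega>, z) \<partial>std_normal_distribution)"
  proof (rule Bochner_Integration.integral_cong[OF refl])
    fix \<omega> assume "\<omega> \<in> space M"
    then have [measurable]: "A \<omega> \<in> space N" by (rule measurable_space[rotated]) measurable
    show "(\<integral>b. f (A \<omega>, g b) \<partial>distr M L B) = (\<integral>z. f (A \<omega>, z) \<partial>std_normal_distribution)"
      unfolding B[symmetric] by (subst (1 2) integral_distr) auto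
  qed
  finally show ?thesis .
qed

locale gaussian_ema = prob_space M for M :: "'a measure" +
  fixes X :: "int \<Rightarrow> 'a \<Rightarrow> real" and \<alpha> \<eta> :: real
  assumes indep: "indep_vars (\<lambda>_. borel) X UNIV"
    and normal: "\<And>s. distributed M lborel (X s) std_normal_density"
    and \<alpha>_nonneg: "0 \<le> \<alpha>" and \<alpha>_less_1: "\<alpha> < 1" and \<eta>_pos: "0 < \<eta>"
begin

abbreviation "S \<equiv> ema \<alpha> X"
abbreviation "V n \<equiv> recent_sign n \<eta> (ema \<alpha> X)"
definition "c = sqrt (1 - \<alpha>\<^sup>2)"

lemma c_pos: "0 < c" and c_square: "c\<^sup>2 = 1 - \<alpha>\<^sup>2"
proof -
  have "\<alpha>\<^sup>2 < 1" using \<alpha>_nonneg \<alpha>_less_1 by (simp add: abs_square_less_1)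
  then show "0 < c" "c\<^sup>2 = 1 - \<alpha>\<^sup>2" by (auto simp: c_def)
qed

lemma measurable_X [measurable]: "X s \<in> borel_measurable M"
  using distributed_measurable[OF normal] by simp

lemma measurable_S [measurable]: "S s \<in> borel_measurable M"
  by (rule measurable_ema) measurable

lemma measurable_V [measurable]: "V n s \<in> borel_measurable M"
  by (rule measurable_recent_sign) measurable

lemma distr_X: "distr M borel (X s) = std_normal_distribution"
  using distributed_distr_eq_density[OF normal] by (metis distr_cong sets_lborel)

lemma expectation_X:
  fixes f :: "real \<Rightarrow> real"
  assumes [measurable]: "f \<in> borel_measurable borel"
  shows "expectation (\<lambda>\<omega>. f (X s \<omega>)) = (\<integral>z. f z \<partial>std_normal_distribution)"
  unfolding distr_X[of s, symmetric] by (subst integral_distr) auto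

lemma integrable_X: "integrable M (X s)"
  using integrable_std_normal_distribution_moment[of 1]
  unfolding distr_X[of s, symmetric] by (subst (asm) integrable_distr_eq) auto

text \<open>
The expected absolute sum is a convergent geometric series.
\<close>

lemma AE_summable: "AE \<omega> in M. \<forall>t. summable (\<lambda>j. \<alpha> ^ j * X (t - int j) \<omega>)"
proof (subst AE_all_countable, rule allI)
  fix t
  define K where "K = (\<integral>z. \<bar>z\<bar> \<partial>std_normal_distribution)"
  have K: "(\<integral>\<^sup>+\<omega>. ennreal \<bar>X s \<omega>\<bar> \<partial>M) = ennreal K" for s
    using integrable_X[of s] expectation_X[of abs s] by (subst nn_integral_eq_integral) (auto simp: K_def)
  have K0: "0 \<le> K" by (simp add: K_def)
  have "(\<integral>\<^sup>+\<omega>. (\<Sum>j. ennreal \<bar>\<alpha> ^ j * X (t - int j) \<omega>\<bar>) \<partial>M)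
      = (\<Sum>j. \<integral>\<^sup>+\<omega>. ennreal \<bar>\<alpha> ^ j * X (t - int j) \<omega>\<bar> \<partial>M)"
    by (intro nn_integral_suminf) measurable
  also have "\<dots> = (\<Sum>j. ennreal (\<alpha> ^ j * K))"
    using \<alpha>_nonneg K0 by (simp add: abs_mult ennreal_mult nn_integral_cmult K)
  also have "\<dots> = ennreal (\<Sum>j. \<alpha> ^ j * K)"
    using \<alpha>_nonneg \<alpha>_less_1 K0 by (intro suminf_ennreal2 summable_mult2 summable_geometric) auto
  also have "\<dots> \<noteq> \<infinity>" by simp
  finally have "AE \<omega> in M. (\<Sum>j. ennreal \<bar>\<alpha> ^ j * X (t - int j) \<omega>\<bar>) \<noteq> \<infinity>"
    by (intro nn_integral_PInf_AE) measurable
  then show "AE \<omega> in M. summable (\<lambda>j. \<alpha> ^ j * X (t - int j) \<omega>)"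
  proof eventually_elim
    case (elim \<omega>)
    have "summable (\<lambda>j. \<bar>\<alpha> ^ j * X (t - int j) \<omega>\<bar>)"
      by (rule summable_suminf_not_top) (use elim in auto)
    then show ?case by (rule summable_rabs_cancel)
  qed
qed

lemma AE_rec: "AE \<omega> in M. \<forall>t. S t \<omega> = \<alpha> * S (t - 1) \<omega> + c * X t \<omega>"
  using AE_summable unfolding c_def
  by eventually_elim (blast intro: ema_rec)

text \<open>
The partial sums of the moving average have Gaussian characteristic functions with variances
\<open>1 - \<alpha> ^ (2 * N)\<close>. These converge, and so do the partial sums almost surely; a distribution is
determined by its characteristic function.
\<close>

lemma distr_S: "distr M borel (S t) = std_normal_distribution"
proof (rule Levy_uniqueness)
  show "real_distribution (distr M borel (S t))" by simp
  show "real_distribution std_normal_distribution" by (rule real_dist_normal_dist)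
  define P where "P N \<omega> = (\<Sum>j<N. c * \<alpha> ^ j * X (t - int j) \<omega>)" for N \<omega>
  have [measurable]: "P N \<in> borel_measurable M" for N unfolding P_def by measurable
  show "char (distr M borel (S t)) = char std_normal_distribution"
  proof
    fix x
    have char_X: "char (distr M borel (\<lambda>\<omega>. a * X s \<omega>)) x = of_real (exp (- ((a * x)\<^sup>2 / 2)))" for a s
    proof -
      have "char (distr M borel (\<lambda>\<omega>. a * X s \<omega>)) x = char (distr M borel (X s)) (a * x)"
        unfolding char_def by (subst (1 2) integral_distr) (auto simp: ac_simps)
      then show ?thesis by (simp add: distr_X char_std_normal_distribution)
    qed
    have char_P: "char (distr M borel (P N)) x = of_real (exp (- ((1 - \<alpha> ^ (2 * N)) * x\<^sup>2 / 2)))" for N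
    proof -
      \<comment> \<open>The sum is indexed by the times \<open>t - j\<close>, the index set of the independent family.\<close>
      let ?I = "(\<lambda>j. t - int j) ` {..<N}"
      have inj: "inj_on (\<lambda>j. t - int j) {..<N}" by (auto simp: inj_on_def)
      have "indep_vars (\<lambda>_. borel) (\<lambda>i \<omega>. c * \<alpha> ^ nat (t - i) * X i \<omega>) ?I"
        by (rule indep_vars_compose2[OF indep_vars_subset[OF indep]]) auto
      then have "char (distr M borel (\<lambda>\<omega>. \<Sum>i\<in>?I. c * \<alpha> ^ nat (t - i) * X i \<omega>)) x
          = (\<Prod>i\<in>?I. char (distr M borel (\<lambda>\<omega>. c * \<alpha> ^ nat (t - i) * X i \<omega>)) x)"
        by (rule char_distr_sum)
      also have "\<dots> = (\<Prod>j<N. of_real (exp (- ((c * \<alpha> ^ j * x)\<^sup>2 / 2))))"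
        by (simp add: prod.reindex[OF inj] char_X)
      also have "\<dots> = of_real (exp (- ((1 - \<alpha> ^ (2 * N)) * x\<^sup>2 / 2)))"
      proof (induction N)
        case (Suc N)
        have e: "(\<alpha> ^ N)\<^sup>2 = \<alpha> ^ (2 * N)" by (simp add: power_mult[symmetric] mult.commute)
        have "(1 - \<alpha> ^ (2 * N)) * x\<^sup>2 + (c * \<alpha> ^ N * x)\<^sup>2 = (1 - \<alpha> ^ (2 * Suc N)) * x\<^sup>2"
          unfolding power_mult_distrib c_square e by (simp add: algebra_simps power2_eq_square)
        then show ?case using Suc.IH
          by (simp add: of_real_mult[symmetric] exp_add[symmetric] add_divide_distrib[symmetric]
              del: of_real_mult of_real_exp)
      qed simp
      finally show ?thesis by (simp add: sum.reindex[OF inj] P_def[abs_def])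
    qed
    have "(\<lambda>N. char (distr M borel (P N)) x) \<longlonglongrightarrow> char (distr M borel (S t)) x"
    proof -
      have "(\<lambda>N. CLINT \<omega>|M. iexp (x * P N \<omega>)) \<longlonglongrightarrow> (CLINT \<omega>|M. iexp (x * S t \<omega>))"
      proof (rule integral_dominated_convergence[where w = "\<lambda>_. 1"])
        show "AE \<omega> in M. (\<lambda>N. iexp (x * P N \<omega>)) \<longlonglongrightarrow> iexp (x * S t \<omega>)"
          using AE_summable
        proof eventually_elim
          case (elim \<omega>)
          then have "(\<lambda>N. c * (\<Sum>j<N. \<alpha> ^ j * X (t - int j) \<omega>)) \<longlonglongrightarrow> c * (\<Sum>j. \<alpha> ^ j * X (t - int j) \<omega>)"
            by (intro tendsto_mult_left summable_LIMSEQ) auto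
          then have "(\<lambda>N. P N \<omega>) \<longlonglongrightarrow> S t \<omega>"
            by (simp add: P_def ema_def c_def sum_distrib_left mult.assoc)
          then show ?case by (intro tendsto_intros)
        qed
      qed auto
      then show ?thesis unfolding char_def by (subst (1 2) integral_distr) auto
    qed
    moreover have "(\<lambda>N. char (distr M borel (P N)) x) \<longlonglongrightarrow> of_real (exp (- ((1 - 0) * x\<^sup>2 / 2)))"
      unfolding char_P power_mult
      by (intro tendsto_intros LIMSEQ_power_zero) (use c_square c_pos \<alpha>_nonneg in \<open>auto simp: abs_square_less_1 \<alpha>_less_1\<close>)
    ultimately show "char (distr M borel (S t)) x = char std_normal_distribution x"
      using LIMSEQ_unique by (fastforce simp: char_std_normal_distribution)
  qed
qed

lemma expectation_S:
  fixes f :: "real \<Rightarrow> real"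
  assumes [measurable]: "f \<in> borel_measurable borel"
  shows "expectation (\<lambda>\<omega>. f (S s \<omega>)) = (\<integral>z. f z \<partial>std_normal_distribution)"
  unfolding distr_S[of s, symmetric] by (subst integral_distr) auto

text \<open>
Position and signal at time \<open>t - 1\<close> are functions of the innovations up to time \<open>t - 1\<close>, hence
independent of \<open>X t\<close>.
\<close>

lemma expectation_past_noise:
  fixes f :: "(real \<times> real) \<times> real \<Rightarrow> real"
  assumes [measurable]: "f \<in> borel_measurable ((borel \<Otimes>\<^sub>M borel) \<Otimes>\<^sub>M borel)"
    and int: "integrable M (\<lambda>\<omega>. f ((V n (t - 1) \<omega>, S (t - 1) \<omega>), X t \<omega>))"
  shows "expectation (\<lambda>\<omega>. f ((V n (t - 1) \<omega>, S (t - 1) \<omega>), X t \<omega>))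
    = expectation (\<lambda>\<omega>. \<integral>z. f ((V n (t - 1) \<omega>, S (t - 1) \<omega>), z) \<partial>std_normal_distribution)"
proof -
  let ?A = "{..t - 1}"
  let ?S = "ema \<alpha> (\<lambda>i x. x i)"
  define V' where "V' = recent_sign n \<eta> ?S (t - 1)"
  have S: "?S s (restrict (\<lambda>i. X i \<omega>) ?A) = S s \<omega>" if "s \<le> t - 1" for s \<omega>
    by (rule ema_cong) (use that in auto)
  have V: "V' (restrict (\<lambda>i. X i \<omega>) ?A) = V n (t - 1) \<omega>" for \<omega>
    unfolding V'_def by (rule recent_sign_cong) (rule S)
  have mS: "?S s \<in> borel_measurable (PiM ?A (\<lambda>_. borel))" if "s \<le> t - 1" for s
    by (rule measurable_ema) (use that in auto)
  have [measurable]: "?S (t - 1) \<in> borel_measurable (PiM ?A (\<lambda>_. borel))" "V' \<in> borel_measurable (PiM ?A (\<lambda>_. borel))"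
    unfolding V'_def by (intro measurable_recent_sign mS; simp)+
  have "indep_var (PiM ?A (\<lambda>_. borel)) (\<lambda>\<omega>. restrict (\<lambda>i. X i \<omega>) ?A)
      (PiM {t} (\<lambda>_. borel)) (\<lambda>\<omega>. restrict (\<lambda>i. X i \<omega>) {t})"
    by (rule indep_var_restrict[OF indep]) auto
  from expectation_indep_std_normal[OF this, of "\<lambda>x. x t" "\<lambda>(x, z). f ((V' x, ?S (t - 1) x), z)"] int
  show ?thesis by (simp add: S V distr_X)
qed

text \<open>
If the signal stayed in the band at all past times, the recursion would bound every past
innovation by \<open>2 * \<eta> / c\<close>. Independent identically distributed innovations do this with
probability at most \<open>p ^ n\<close> for every \<open>n\<close>, where \<open>p < 1\<close>.
\<close>

lemma AE_signal_exceeds: "AE \<omega> in M. \<exists>j. \<eta> \<le> \<bar>S (t - int j) \<omega>\<bar>"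
proof -
  define b where "b = 2 * \<eta> / c"
  define A where "A = {z. \<bar>z\<bar> < b}"
  have [measurable]: "A \<in> sets borel" unfolding A_def by measurable
  define p where "p = (\<integral>z. indicat_real A z \<partial>std_normal_distribution)"
  interpret G: real_distribution std_normal_distribution by (rule real_dist_normal_dist)
  have "0 < (\<integral>z. indicat_real (- A) z \<partial>std_normal_distribution)"
    by (rule std_normal_integral_pos[where a = b and b = "b + 1"])
      (auto simp: A_def less_top[symmetric] intro!: G.integrable_const_bound[where B = 1] split: split_indicator)
  also have "\<dots> = (\<integral>z. 1 - indicat_real A z \<partial>std_normal_distribution)"
    by (intro Bochner_Integration.integral_cong) (auto split: split_indicator)
  also have "\<dots> = 1 - p"
    unfolding p_def by (subst Bochner_Integration.integral_diff) (auto simp: less_top[symmetric] G.prob_space[simplified])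
  finally have p1: "p < 1" by simp
  have p0: "0 \<le> p" unfolding p_def by (rule Bochner_Integration.integral_nonneg) auto
  have pX: "prob (X s -` A \<inter> space M) = p" for s
    using expectation_X[of "indicator A" s] by (simp add: p_def indicator_vimage[symmetric])
  define N where "N = {\<omega> \<in> space M. \<forall>j. X (t - int j) \<omega> \<in> A}"
  have [measurable]: "N \<in> events" unfolding N_def by measurable
  have "prob N \<le> p ^ Suc n" for n
  proof -
    let ?J = "(\<lambda>j. t - int j) ` {..<Suc n}"
    have inj: "inj_on (\<lambda>j. t - int j) {..<Suc n}" by (auto simp: inj_on_def)
    have "prob N \<le> prob (\<Inter>i\<in>?J. X i -` A \<inter> space M)"
      by (rule finite_measure_mono) (auto simp: N_def)
    also have "\<dots> = (\<Prod>i\<in>?J. prob (X i -` A \<inter> space M))"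
      by (rule indep_varsD[OF indep]) auto
    also have "\<dots> = p ^ Suc n"
      by (simp only: pX prod_constant card_image[OF inj] card_lessThan)
    finally show ?thesis .
  qed
  moreover have "(\<lambda>n. p ^ Suc n) \<longlonglongrightarrow> 0"
    using LIMSEQ_power_zero[of p] p0 p1 by (intro LIMSEQ_Suc) auto
  ultimately have "prob N \<le> 0" by (intro LIMSEQ_le_const) auto
  then have "prob N = 0" using measure_nonneg[of M N] by linarith
  then have "AE \<omega> in M. \<omega> \<notin> N" by (subst (asm) prob_eq_0) auto
  with AE_rec AE_space show ?thesis
  proof eventually_elim
    case (elim \<omega>)
    show ?case
    proof (rule ccontr)
      assume "\<not> ?thesis"
      then have less: "\<bar>S (t - int j) \<omega>\<bar> < \<eta>" for j by (auto simp: not_le)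
      have "X (t - int j) \<omega> \<in> A" for j
      proof -
        \<comment> \<open>Both signal values lie in the band, so the innovation is small.\<close>
        have "c * X (t - int j) \<omega> = S (t - int j) \<omega> - \<alpha> * S (t - int (Suc j)) \<omega>"
          using elim(1)[rule_format, of "t - int j"] by (simp add: algebra_simps)
        moreover have "\<bar>\<alpha> * S (t - int (Suc j)) \<omega>\<bar> < \<eta>"
        proof -
          have "\<bar>\<alpha> * S (t - int (Suc j)) \<omega>\<bar> \<le> \<bar>S (t - int (Suc j)) \<omega>\<bar>"
            using \<alpha>_nonneg \<alpha>_less_1 by (simp add: abs_mult mult_left_le_one_le)
          with less[of "Suc j"] show ?thesis by linarith
        qed
        ultimately have "\<bar>c * X (t - int j) \<omega>\<bar> < 2 * \<eta>" using less[of j] by linarith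
        then show ?thesis using c_pos by (simp add: A_def b_def abs_mult field_simps)
      qed
      with elim(2,3) show False by (auto simp: N_def)
    qed
  qed
qed

section \<open>One step of the correlation and of the association\<close>

text \<open>
The density of the innovation at the level that brings the signal from \<open>s\<close> to \<open>- \<eta>\<close>. The level
that brings it to \<open>\<eta>\<close> has density \<open>q (- s)\<close>.
\<close>

definition "q s = std_normal_density ((\<eta> + \<alpha> * s) / c)"

lemma measurable_q [measurable]: "q \<in> borel_measurable borel"
  unfolding q_def by measurable

lemma q_pos: "0 < q s" and q_le_1: "q s \<le> 1"
  by (auto simp: q_def normal_density_pos std_normal_density_le_1)

lemma q_mono: "s \<le> r \<Longrightarrow> 0 \<le> s + r \<Longrightarrow> q r \<le> q s"
proof -
  assume "s \<le> r" "0 \<le> s + r"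
  have "0 \<le> (\<alpha> * (r - s)) * (2 * \<eta> + \<alpha> * (s + r))"
    using \<open>s \<le> r\<close> \<open>0 \<le> s + r\<close> \<alpha>_nonneg \<eta>_pos by simp
  then have "(\<eta> + \<alpha> * s)\<^sup>2 \<le> (\<eta> + \<alpha> * r)\<^sup>2"
    by (simp add: algebra_simps power2_eq_square)
  then show ?thesis unfolding q_def
    by (intro std_normal_density_mono) (simp add: power_divide divide_right_mono)
qed

lemma q_strict_mono: "0 < \<alpha> \<Longrightarrow> s < r \<Longrightarrow> 0 \<le> s + r \<Longrightarrow> q r < q s"
proof -
  assume "0 < \<alpha>" "s < r" "0 \<le> s + r"
  have "0 < (\<alpha> * (r - s)) * (2 * \<eta> + \<alpha> * (s + r))"
    using \<open>s < r\<close> \<open>0 \<le> s + r\<close> \<open>0 < \<alpha>\<close> \<eta>_pos by (intro mult_pos_pos add_pos_nonneg) auto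
  then have "(\<eta> + \<alpha> * s)\<^sup>2 < (\<eta> + \<alpha> * r)\<^sup>2"
    by (simp add: algebra_simps power2_eq_square)
  then show ?thesis unfolding q_def using c_pos
    by (intro std_normal_density_strict_mono) (simp add: power_divide divide_strict_right_mono)
qed

lemma sign_aligned_q: "sign_aligned (\<lambda>s. q (- s) - q s)"
proof -
  have "\<bar>q (- s) - q s\<bar> \<le> 1" for s using q_pos[of s] q_pos[of "- s"] q_le_1[of s] q_le_1[of "- s"] by linarith
  moreover have "0 \<le> q (- s) - q s" if "0 \<le> s" for s using q_mono[of "- s" s] that by simp
  ultimately show ?thesis unfolding sign_aligned_def by auto
qed

text \<open>
With \<open>a\<close> and \<open>- b\<close> the innovations leading to \<open>\<eta>\<close> and \<open>- \<eta>\<close>, the next position is \<open>v\<close>, changed by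
\<open>1 - v\<close> above \<open>a\<close> and by \<open>- (1 + v)\<close> below \<open>- b\<close>. The constant \<open>v\<close> contributes nothing, and each tail
contributes the density at its end point.
\<close>

lemma mean_hold:
  "(\<integral>z. z * hold \<eta> (\<alpha> * s + c * z) v \<partial>std_normal_distribution) = q s + q (- s) - v * (q (- s) - q s)"
proof -
  define a b where "a = (\<eta> - \<alpha> * s) / c" and "b = (\<eta> + \<alpha> * s) / c"
  have ab: "- b < a" using c_pos \<eta>_pos by (simp add: a_def b_def field_simps)
  have int: "integrable std_normal_distribution (\<lambda>z. z)"
    using integrable_std_normal_distribution_moment[of 1] by simp
  have int': "integrable std_normal_distribution (\<lambda>z. z * indicator A z)" if "A \<in> sets borel" for A
    using integrable_mult_indicator[OF _ int, of A] that by (simp add: mult.commute)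
  have mean: "(\<integral>z. z \<partial>std_normal_distribution) = 0"
    using integral_std_normal_distribution_moment_odd[of 1] by simp
  have lower: "(\<integral>z. z * indicator {..- b} z \<partial>std_normal_distribution) = - q s"
  proof -
    have "(\<integral>z. z * indicator {..- b} z \<partial>std_normal_distribution) = (\<integral>z. (- z) * indicator {..- b} (- z) \<partial>std_normal_distribution)"
      by (rule std_normal_integral_reflect[symmetric]) measurable
    also have "\<dots> = (\<integral>z. - (z * indicator {b..} z) \<partial>std_normal_distribution)"
      by (rule Bochner_Integration.integral_cong) (auto split: split_indicator)
    also have "\<dots> = - q s" by (simp add: std_normal_tail_mean b_def q_def)
    finally show ?thesis .
  qed
  have eq: "z * hold \<eta> (\<alpha> * s + c * z) v = v * z + (1 - v) * (z * indicator {a..} z) - (1 + v) * (z * indicator {..- b} z)" for z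
  proof -
    have "\<eta> \<le> \<alpha> * s + c * z \<longleftrightarrow> a \<le> z" "\<alpha> * s + c * z \<le> - \<eta> \<longleftrightarrow> z \<le> - b"
      using c_pos by (auto simp: a_def b_def field_simps)
    then show ?thesis using ab by (auto simp: hold_def indicator_def algebra_simps)
  qed
  have "(\<integral>z. z * hold \<eta> (\<alpha> * s + c * z) v \<partial>std_normal_distribution)
    = v * 0 + (1 - v) * std_normal_density a - (1 + v) * - q s"
    unfolding eq using int int'
    by (simp add: Bochner_Integration.integral_diff Bochner_Integration.integral_add mean lower std_normal_tail_mean)
  also have "std_normal_density a = q (- s)" by (simp add: q_def a_def)
  finally show ?thesis by (simp add: algebra_simps)
qed

lemma integrable_bounded:
  fixes f :: "'a \<Rightarrow> real"
  assumes [measurable]: "f \<in> borel_measurable M" and B: "\<And>\<omega>. \<bar>f \<omega>\<bar> \<le> B"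
  shows "integrable M f"
  by (rule integrable_const_bound[where B = B]) (use B in auto)

lemma integrable_V_mult:
  fixes f :: "'a \<Rightarrow> real"
  assumes "integrable M f"
  shows "integrable M (\<lambda>\<omega>. V n t \<omega> * f \<omega>)"
proof -
  have [measurable]: "f \<in> borel_measurable M" using assms by auto
  show ?thesis
    by (rule Bochner_Integration.integrable_bound[OF assms])
      (auto simp: abs_mult intro!: AE_I2 mult_left_le_one_le abs_recent_sign_le)
qed

lemma corr_step:
  "expectation (\<lambda>\<omega>. V (Suc n) t \<omega> * X t \<omega>)
    = expectation (\<lambda>\<omega>. q (S (t - 1) \<omega>) + q (- S (t - 1) \<omega>) - V n (t - 1) \<omega> * (q (- S (t - 1) \<omega>) - q (S (t - 1) \<omega>)))"
proof -
  let ?f = "\<lambda>w. snd w * hold \<eta> (\<alpha> * snd (fst w) + c * snd w) (fst (fst w))"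
  have eq: "AE \<omega> in M. V (Suc n) t \<omega> * X t \<omega> = ?f ((V n (t - 1) \<omega>, S (t - 1) \<omega>), X t \<omega>)"
    using AE_rec
  proof eventually_elim
    case (elim \<omega>)
    then have "S t \<omega> = \<alpha> * S (t - 1) \<omega> + c * X t \<omega>" by blast
    then show ?case by (simp only: recent_sign.simps fst_conv snd_conv mult.commute)
  qed
  have int: "integrable M (\<lambda>\<omega>. ?f ((V n (t - 1) \<omega>, S (t - 1) \<omega>), X t \<omega>))"
    using integrable_V_mult[OF integrable_X, of "Suc n" t t] by (rule integrable_cong_AE_imp) (use eq in auto)
  have "expectation (\<lambda>\<omega>. V (Suc n) t \<omega> * X t \<omega>) = expectation (\<lambda>\<omega>. ?f ((V n (t - 1) \<omega>, S (t - 1) \<omega>), X t \<omega>))"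
    by (rule integral_cong_AE) (use eq in auto)
  also have "\<dots> = expectation (\<lambda>\<omega>. \<integral>z. ?f ((V n (t - 1) \<omega>, S (t - 1) \<omega>), z) \<partial>std_normal_distribution)"
    by (rule expectation_past_noise[OF _ int]) measurable
  finally show ?thesis by (simp add: mean_hold)
qed

lemma signal_step:
  assumes [measurable]: "h \<in> borel_measurable borel" and B: "\<And>x. \<bar>h x\<bar> \<le> B"
  shows "expectation (\<lambda>\<omega>. V n (t - 1) \<omega> * h (S t \<omega>))
    = expectation (\<lambda>\<omega>. V n (t - 1) \<omega> * ema_transition \<alpha> h (S (t - 1) \<omega>))"
proof -
  let ?f = "\<lambda>w. fst (fst w) * h (\<alpha> * snd (fst w) + c * snd w)"
  have eq: "AE \<omega> in M. V n (t - 1) \<omega> * h (S t \<omega>) = ?f ((V n (t - 1) \<omega>, S (t - 1) \<omega>), X t \<omega>)"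
    using AE_rec
  proof eventually_elim
    case (elim \<omega>)
    then have "S t \<omega> = \<alpha> * S (t - 1) \<omega> + c * X t \<omega>" by blast
    then show ?case by simp
  qed
  have int: "integrable M (\<lambda>\<omega>. ?f ((V n (t - 1) \<omega>, S (t - 1) \<omega>), X t \<omega>))"
    using integrable_V_mult[OF integrable_bounded[OF _ B], of "S t" n "t - 1"]
    by (rule integrable_cong_AE_imp) (use eq in auto)
  have "expectation (\<lambda>\<omega>. V n (t - 1) \<omega> * h (S t \<omega>)) = expectation (\<lambda>\<omega>. ?f ((V n (t - 1) \<omega>, S (t - 1) \<omega>), X t \<omega>))"
    by (rule integral_cong_AE) (use eq in auto)
  also have "\<dots> = expectation (\<lambda>\<omega>. \<integral>z. ?f ((V n (t - 1) \<omega>, S (t - 1) \<omega>), z) \<partial>std_normal_distribution)"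
    by (rule expectation_past_noise[OF _ int]) measurable
  finally show ?thesis by (simp add: ema_transition_def c_def)
qed

text \<open>
Outside the band the position is the sign of the signal, so \<open>h\<close> contributes its absolute value;
inside, the position is the previous one and the signal can be averaged over its last step.
\<close>

lemma association_step:
  assumes h: "sign_aligned h"
  shows "expectation (\<lambda>\<omega>. V (Suc n) t \<omega> * h (S t \<omega>))
    = tail_mean \<eta> h + expectation (\<lambda>\<omega>. V n (t - 1) \<omega> * ema_transition \<alpha> (inner_part \<eta> h) (S (t - 1) \<omega>))"
proof -
  obtain B where [measurable]: "h \<in> borel_measurable borel" and odd: "\<And>x. h (- x) = - h x"
      and nonneg: "\<And>x. 0 \<le> x \<Longrightarrow> 0 \<le> h x" and B: "\<And>x. \<bar>h x\<bar> \<le> B"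
    using h unfolding sign_aligned_def by blast
  obtain B' where i[measurable]: "inner_part \<eta> h \<in> borel_measurable borel" and B': "\<And>x. \<bar>inner_part \<eta> h x\<bar> \<le> B'"
    using sign_aligned_inner_part[OF h] unfolding sign_aligned_def by blast
  have B0: "0 \<le> B" using B[of 0] by simp
  have "V (Suc n) t \<omega> * h (S t \<omega>)
      = \<bar>h (S t \<omega>)\<bar> * indicator {s. \<eta> \<le> \<bar>s\<bar>} (S t \<omega>) + V n (t - 1) \<omega> * inner_part \<eta> h (S t \<omega>)" for \<omega>
    using nonneg[of "S t \<omega>"] nonneg[of "- S t \<omega>"] odd[of "S t \<omega>"] \<eta>_pos
    by (cases "0 \<le> S t \<omega>") (auto simp: hold_def inner_part_def indicator_def)
  then have "expectation (\<lambda>\<omega>. V (Suc n) t \<omega> * h (S t \<omega>))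
    = expectation (\<lambda>\<omega>. \<bar>h (S t \<omega>)\<bar> * indicator {s. \<eta> \<le> \<bar>s\<bar>} (S t \<omega>) + V n (t - 1) \<omega> * inner_part \<eta> h (S t \<omega>))"
    by simp
  also have "\<dots> = expectation (\<lambda>\<omega>. \<bar>h (S t \<omega>)\<bar> * indicator {s. \<eta> \<le> \<bar>s\<bar>} (S t \<omega>))
     + expectation (\<lambda>\<omega>. V n (t - 1) \<omega> * inner_part \<eta> h (S t \<omega>))"
  proof (rule Bochner_Integration.integral_add)
    show "integrable M (\<lambda>\<omega>. \<bar>h (S t \<omega>)\<bar> * indicator {s. \<eta> \<le> \<bar>s\<bar>} (S t \<omega>))"
      by (rule integrable_bounded[where B = B]) (use B B0 in \<open>auto split: split_indicator\<close>)
    show "integrable M (\<lambda>\<omega>. V n (t - 1) \<omega> * inner_part \<eta> h (S t \<omega>))"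
      by (rule integrable_V_mult[OF integrable_bounded]) (use B' in auto)
  qed
  also have "expectation (\<lambda>\<omega>. \<bar>h (S t \<omega>)\<bar> * indicator {s. \<eta> \<le> \<bar>s\<bar>} (S t \<omega>)) = tail_mean \<eta> h"
    unfolding tail_mean_def by (rule expectation_S[where f = "\<lambda>s. \<bar>h s\<bar> * indicator {s. \<eta> \<le> \<bar>s\<bar>} s"]) measurable
  finally show ?thesis by (simp only: signal_step[OF i B'])
qed

lemma association_nonneg: "sign_aligned h \<Longrightarrow> 0 \<le> expectation (\<lambda>\<omega>. V n t \<omega> * h (S t \<omega>))"
proof (induction n arbitrary: h t)
  case (Suc n)
  have "0 \<le> expectation (\<lambda>\<omega>. V n (t - 1) \<omega> * ema_transition \<alpha> (inner_part \<eta> h) (S (t - 1) \<omega>))"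
    by (intro Suc.IH sign_aligned_transition \<alpha>_nonneg \<alpha>_less_1 sign_aligned_inner_part Suc.prems)
  then show ?case
    unfolding association_step[OF Suc.prems] using tail_mean_nonneg by (rule add_nonneg_nonneg[rotated])
qed simp

text \<open>
Two steps of the recursion are kept. The first term is what the coin comparison already
contains; the second is the strict gain of the true rule over the coin.
\<close>

lemma association_ge:
  assumes h: "sign_aligned h"
  shows "tail_mean \<eta> h + tail_mean \<eta> (ema_transition \<alpha> (inner_part \<eta> h))
    \<le> expectation (\<lambda>\<omega>. V (Suc (Suc n)) t \<omega> * h (S t \<omega>))"
proof -
  have 1: "sign_aligned (ema_transition \<alpha> (inner_part \<eta> h))"
    by (intro sign_aligned_transition \<alpha>_nonneg \<alpha>_less_1 sign_aligned_inner_part h)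
  have 2: "sign_aligned (ema_transition \<alpha> (inner_part \<eta> (ema_transition \<alpha> (inner_part \<eta> h))))"
    by (intro sign_aligned_transition \<alpha>_nonneg \<alpha>_less_1 sign_aligned_inner_part h)
  show ?thesis
    unfolding association_step[OF h, of "Suc n"] association_step[OF 1] 
    using association_nonneg[OF 2] by simp
qed

text \<open>
One step from outside the band, the sign of the signal inside the band still leans towards the
sign it had before.
\<close>

lemma tail_mean_transition_pos:
  assumes "0 < \<alpha>" and h: "sign_aligned h" and pos: "\<And>s. 0 < s \<Longrightarrow> 0 < h s"
  shows "0 < tail_mean \<eta> (ema_transition \<alpha> (inner_part \<eta> h))"
proof -
  let ?k = "ema_transition \<alpha> (inner_part \<eta> h)"
  obtain B where i: "inner_part \<eta> h \<in> borel_measurable borel" "\<And>x. inner_part \<eta> h (- x) = - inner_part \<eta> h x"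
     "\<And>x. \<bar>inner_part \<eta> h x\<bar> \<le> B" "\<And>x. 0 \<le> x \<Longrightarrow> 0 \<le> inner_part \<eta> h x"
    using sign_aligned_inner_part[OF h] unfolding sign_aligned_def by blast
  have kpos: "0 < ?k s" if "0 < s" for s
    by (rule ema_transition_pos[OF \<open>0 < \<alpha>\<close> \<alpha>_less_1 i that \<eta>_pos]) (auto simp: inner_part_def pos)
  have kB: "\<bar>?k s\<bar> \<le> B" for s by (rule ema_transition_bounded[OF i(1,3)])
  have [measurable]: "?k \<in> borel_measurable borel" using i(1) by (rule measurable_ema_transition)
  show ?thesis
    unfolding tail_mean_def
  proof (rule std_normal_integral_pos[where a = \<eta> and b = "\<eta> + 1"])
    show "integrable std_normal_distribution (\<lambda>s. \<bar>?k s\<bar> * indicator {s. \<eta> \<le> \<bar>s\<bar>} s)"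
      by (rule integrable_std_normal_bounded[where B = B])
        (use kB kB[THEN order_trans[OF abs_ge_zero]] in \<open>auto split: split_indicator\<close>)
    show "0 < \<bar>?k s\<bar> * indicator {s. \<eta> \<le> \<bar>s\<bar>} s" if "\<eta> < s" for s
      using kpos[of s] that \<eta>_pos by simp
  qed auto
qed

section \<open>Bounds on the correlation and the passage to the limit\<close>

text \<open>
Whatever the position in \<open>[-1, 1]\<close>, the conditional mean of \<open>corr_step\<close> is at least \<open>2 * q \<bar>s\<bar>\<close>.
This makes the denominator of the ratio of improvement positive in the limit.
\<close>

lemma corr_pos: "\<exists>\<delta>>0. \<forall>n. \<delta> \<le> expectation (\<lambda>\<omega>. V (Suc n) t \<omega> * X t \<omega>)"
proof (intro exI conjI allI)
  let ?f = "\<lambda>s. 2 * q \<bar>s\<bar>"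
  have f: "\<bar>?f s\<bar> \<le> 2" for s using q_pos[of "\<bar>s\<bar>"] q_le_1[of "\<bar>s\<bar>"] by simp
  show "0 < (\<integral>s. ?f s \<partial>std_normal_distribution)"
  proof (rule std_normal_integral_pos[where a = 0 and b = 1])
    show "integrable std_normal_distribution ?f"
      by (rule integrable_std_normal_bounded[OF _ f]) measurable
  qed (use q_pos in \<open>auto simp: less_imp_le\<close>)
  fix n
  have "(\<integral>s. ?f s \<partial>std_normal_distribution) = expectation (\<lambda>\<omega>. ?f (S (t - 1) \<omega>))"
    by (rule expectation_S[symmetric]) measurable
  also have "\<dots> \<le> expectation (\<lambda>\<omega>. V (Suc n) t \<omega> * X t \<omega>)"
    unfolding corr_step
  proof (rule Bochner_Integration.integral_mono)
    show "integrable M (\<lambda>\<omega>. ?f (S (t - 1) \<omega>))"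
      by (rule integrable_bounded[OF _ f]) measurable
    have "integrable M (\<lambda>\<omega>. q (S (t - 1) \<omega>))" "integrable M (\<lambda>\<omega>. q (- S (t - 1) \<omega>))"
      using q_pos q_le_1 by (auto intro!: integrable_bounded[where B = 1] simp: abs_of_pos)
    then show "integrable M (\<lambda>\<omega>. q (S (t - 1) \<omega>) + q (- S (t - 1) \<omega>) - V n (t - 1) \<omega> * (q (- S (t - 1) \<omega>) - q (S (t - 1) \<omega>)))"
      by (intro Bochner_Integration.integrable_diff Bochner_Integration.integrable_add integrable_V_mult)
  next
    fix \<omega>
    let ?s = "S (t - 1) \<omega>" and ?v = "V n (t - 1) \<omega>"
    have v: "\<bar>?v\<bar> \<le> 1" by (rule abs_recent_sign_le)
    have "2 * q \<bar>?s\<bar> = (1 + ?v) * q \<bar>?s\<bar> + (1 - ?v) * q \<bar>?s\<bar>" by (simp add: algebra_simps)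
    also have "\<dots> \<le> (1 + ?v) * q ?s + (1 - ?v) * q (- ?s)"
      using v by (intro add_mono mult_left_mono q_mono) auto
    also have "\<dots> = q ?s + q (- ?s) - ?v * (q (- ?s) - q ?s)" by (simp add: algebra_simps)
    finally show "?f ?s \<le> q ?s + q (- ?s) - ?v * (q (- ?s) - q ?s)" .
  qed
  finally show "(\<integral>s. ?f s \<partial>std_normal_distribution) \<le> expectation (\<lambda>\<omega>. V (Suc n) t \<omega> * X t \<omega>)" .
qed

text \<open>
The memory has length at least 3: one step is used by \<open>corr_step\<close>, one by the part of the
association outside the band, and one by the strict gain.
\<close>

lemma corr_upper:
  assumes "0 < \<alpha>"
  shows "\<exists>\<delta>>0. \<forall>n. expectation (\<lambda>\<omega>. V (Suc (Suc (Suc n))) t \<omega> * X t \<omega>)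
    \<le> 2 * std_normal_density \<eta> * coin_flip_ratio \<alpha> \<eta> - \<delta>"
proof (intro exI conjI allI)
  define h where "h s = q (- s) - q s" for s
  have h: "sign_aligned h" unfolding h_def[abs_def] by (rule sign_aligned_q)
  let ?\<delta> = "tail_mean \<eta> (ema_transition \<alpha> (inner_part \<eta> h))"
  show "0 < ?\<delta>"
    by (rule tail_mean_transition_pos[OF assms h]) (use q_strict_mono[OF assms] in \<open>auto simp: h_def\<close>)
  have h1: "\<bar>h s\<bar> \<le> 1" for s using q_pos[of s] q_pos[of "- s"] q_le_1[of s] q_le_1[of "- s"] by (simp add: h_def)
  have [measurable]: "h \<in> borel_measurable borel" using h by (simp add: sign_aligned_def)
  have q2: "\<bar>q s + q (- s)\<bar> \<le> 2" for s using q_pos[of s] q_pos[of "- s"] q_le_1[of s] q_le_1[of "- s"] by simp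
  fix n
  have "expectation (\<lambda>\<omega>. V (Suc (Suc (Suc n))) t \<omega> * X t \<omega>)
      = expectation (\<lambda>\<omega>. q (S (t - 1) \<omega>) + q (- S (t - 1) \<omega>)) - expectation (\<lambda>\<omega>. V (Suc (Suc n)) (t - 1) \<omega> * h (S (t - 1) \<omega>))"
    unfolding corr_step h_def[symmetric]
  proof (rule Bochner_Integration.integral_diff)
    show "integrable M (\<lambda>\<omega>. q (S (t - 1) \<omega>) + q (- S (t - 1) \<omega>))"
      by (rule integrable_bounded[OF _ q2]) measurable
    show "integrable M (\<lambda>\<omega>. V (Suc (Suc n)) (t - 1) \<omega> * h (S (t - 1) \<omega>))"
      by (rule integrable_V_mult[OF integrable_bounded[OF _ h1]]) measurable
  qed
  also have "expectation (\<lambda>\<omega>. q (S (t - 1) \<omega>) + q (- S (t - 1) \<omega>)) = (\<integral>s. q s + q (- s) \<partial>std_normal_distribution)"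
    by (rule expectation_S) measurable
  also have "\<dots> - expectation (\<lambda>\<omega>. V (Suc (Suc n)) (t - 1) \<omega> * h (S (t - 1) \<omega>))
      \<le> (\<integral>s. q s + q (- s) \<partial>std_normal_distribution) - (tail_mean \<eta> h + ?\<delta>)"
    using association_ge[OF h] by (rule diff_left_mono)
  also have "\<dots> = ((\<integral>s. q s + q (- s) \<partial>std_normal_distribution) - tail_mean \<eta> h) - ?\<delta>"
    by simp
  also have "(\<integral>s. q s + q (- s) \<partial>std_normal_distribution) - tail_mean \<eta> h
     = (\<integral>s. (q s + q (- s)) - \<bar>q (- s) - q s\<bar> * indicator {s. \<eta> \<le> \<bar>s\<bar>} s \<partial>std_normal_distribution)"
    unfolding tail_mean_def h_def[symmetric]
  proof (rule Bochner_Integration.integral_diff[symmetric])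
    show "integrable std_normal_distribution (\<lambda>s. q s + q (- s))"
      by (rule integrable_std_normal_bounded[OF _ q2]) measurable
    show "integrable std_normal_distribution (\<lambda>s. \<bar>h s\<bar> * indicator {s. \<eta> \<le> \<bar>s\<bar>} s)"
      by (rule integrable_std_normal_bounded[where B = 1]) (use h1 in \<open>auto split: split_indicator\<close>)
  qed
  also have "\<dots> = 2 * std_normal_density \<eta> * coin_flip_ratio \<alpha> \<eta>"
    unfolding q_def c_def by (rule coin_flip_integral[OF \<alpha>_nonneg \<alpha>_less_1 \<eta>_pos])
  finally show "expectation (\<lambda>\<omega>. V (Suc (Suc (Suc n))) t \<omega> * X t \<omega>)
    \<le> 2 * std_normal_density \<eta> * coin_flip_ratio \<alpha> \<eta> - ?\<delta>" .
qed

lemma corr_raw: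
  assumes "\<alpha> = 0"
  shows "expectation (\<lambda>\<omega>. V (Suc n) t \<omega> * X t \<omega>) = 2 * std_normal_density \<eta>"
proof -
  have "q s = std_normal_density \<eta>" for s
    unfolding q_def c_def using assms by simp
  then show ?thesis unfolding corr_step by (simp add: prob_space)
qed

text \<open>
Once the memory reaches back to a time at which the signal is outside the band, it reproduces the portfolio; dominated
convergence transfers this to the means. For finite memory the position is a function of \<open>X\<close>
alone, so the noise in the target averages out.
\<close>

lemma corr_limit:
  assumes \<epsilon>: "\<And>s. distributed M lborel (\<epsilon> s) std_normal_density"
    and ind: "indep_var (\<Pi>\<^sub>M s\<in>UNIV. borel) (\<lambda>\<omega> s. X s \<omega>) (\<Pi>\<^sub>M s\<in>UNIV. borel) (\<lambda>\<omega> s. \<epsilon> s \<omega>)"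
    and W: "threshold_portfolio M \<eta> S W"
  shows "(\<lambda>n. \<rho> * expectation (\<lambda>\<omega>. V n t \<omega> * X t \<omega>)) \<longlonglongrightarrow> target_portfolio_corr M W (target \<rho> X \<epsilon>) t"
proof -
  interpret G: real_distribution std_normal_distribution by (rule real_dist_normal_dist)
  have [measurable]: "\<epsilon> t \<in> borel_measurable M" using distributed_measurable[OF \<epsilon>] by simp
  have d\<epsilon>: "distr M borel (\<epsilon> t) = std_normal_distribution"
    using distributed_distr_eq_density[OF \<epsilon>] by (metis distr_cong sets_lborel)
  have int_\<epsilon>: "integrable M (\<epsilon> t)"
    using integrable_std_normal_distribution_moment[of 1]
    unfolding d\<epsilon>[symmetric] by (subst (asm) integrable_distr_eq) auto
  let ?Y = "target \<rho> X \<epsilon> t"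
  have int_Y: "integrable M ?Y"
    unfolding target_def[abs_def] using integrable_X int_\<epsilon> by simp
  have noise: "expectation (\<lambda>\<omega>. V n t \<omega> * \<epsilon> t \<omega>) = 0" for n
  proof -
    let ?V = "recent_sign n \<eta> (ema \<alpha> (\<lambda>i x. x i)) t"
    have [measurable]: "?V \<in> borel_measurable (\<Pi>\<^sub>M s\<in>UNIV. borel)"
      by (intro measurable_recent_sign measurable_ema) simp
    have V: "?V (\<lambda>s. X s \<omega>) = V n t \<omega>" for \<omega>
      by (intro recent_sign_cong ema_cong) simp
    have "expectation (\<lambda>\<omega>. V n t \<omega> * \<epsilon> t \<omega>) = expectation (\<lambda>\<omega>. \<integral>z. V n t \<omega> * z \<partial>std_normal_distribution)"
      using expectation_indep_std_normal[OF ind, of "\<lambda>x. x t" "\<lambda>(x, z). ?V x * z"]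
        integrable_V_mult[OF int_\<epsilon>, of n t]
      by (simp add: V d\<epsilon>)
    also have "\<dots> = 0"
      using integral_std_normal_distribution_moment_odd[of 1] by simp
    finally show ?thesis .
  qed
  have "expectation (\<lambda>\<omega>. V n t \<omega> * ?Y \<omega>) = \<rho> * expectation (\<lambda>\<omega>. V n t \<omega> * X t \<omega>)" for n
  proof -
    have "expectation (\<lambda>\<omega>. V n t \<omega> * ?Y \<omega>)
      = expectation (\<lambda>\<omega>. \<rho> * (V n t \<omega> * X t \<omega>) + sqrt (1 - \<rho>\<^sup>2) * (V n t \<omega> * \<epsilon> t \<omega>))"
      by (simp add: target_def algebra_simps)
    also have "\<dots> = \<rho> * expectation (\<lambda>\<omega>. V n t \<omega> * X t \<omega>) + sqrt (1 - \<rho>\<^sup>2) * expectation (\<lambda>\<omega>. V n t \<omega> * \<epsilon> t \<omega>)"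
      using integrable_V_mult[OF int_\<epsilon>] integrable_V_mult[OF integrable_X]
      by (subst Bochner_Integration.integral_add) auto
    finally show ?thesis by (simp add: noise)
  qed
  moreover have "(\<lambda>n. expectation (\<lambda>\<omega>. V n t \<omega> * ?Y \<omega>)) \<longlonglongrightarrow> expectation (\<lambda>\<omega>. W t \<omega> * ?Y \<omega>)"
  proof (rule integral_dominated_convergence[where w = "\<lambda>\<omega>. \<bar>?Y \<omega>\<bar>"])
    have [measurable]: "?Y \<in> borel_measurable M" using int_Y by auto
    have [measurable]: "W t \<in> borel_measurable M" using W by (simp add: threshold_portfolio_def)
    show "(\<lambda>\<omega>. W t \<omega> * ?Y \<omega>) \<in> borel_measurable M" "(\<lambda>\<omega>. V n t \<omega> * ?Y \<omega>) \<in> borel_measurable M" for n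
      by measurable
    show "integrable M (\<lambda>\<omega>. \<bar>?Y \<omega>\<bar>)" using int_Y by simp
    show "AE \<omega> in M. norm (V n t \<omega> * ?Y \<omega>) \<le> \<bar>?Y \<omega>\<bar>" for n
      by (auto simp: abs_mult intro!: AE_I2 mult_left_le_one_le abs_recent_sign_le)
    have "AE \<omega> in M. \<forall>t. W t \<omega> \<in> {-1, 1} \<and> (S t \<omega> \<ge> \<eta> \<longrightarrow> W t \<omega> = 1) \<and> (S t \<omega> \<le> - \<eta> \<longrightarrow> W t \<omega> = -1) \<and>
        (- \<eta> < S t \<omega> \<and> S t \<omega> < \<eta> \<longrightarrow> W t \<omega> = W (t - 1) \<omega>)"
      using W by (simp add: threshold_portfolio_def)
    with AE_signal_exceeds[of t] show "AE \<omega> in M. (\<lambda>n. V n t \<omega> * ?Y \<omega>) \<longlonglongrightarrow> W t \<omega> * ?Y \<omega>"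
    proof eventually_elim
      case (elim \<omega>)
      then obtain j where j: "\<eta> \<le> \<bar>S (t - int j) \<omega>\<bar>" by blast
      have V: "V n t \<omega> = W t \<omega>" if "j < n" for n
        by (rule recent_sign_eq_portfolio[where S = S and W = W, OF \<eta>_pos _ j that]) (use elim(2) in blast)
      have "\<forall>\<^sub>F n in sequentially. V n t \<omega> * ?Y \<omega> = W t \<omega> * ?Y \<omega>"
        using eventually_gt_at_top[of j] by eventually_elim (simp only: V)
      then show ?case by (rule tendsto_eventually)
    qed
  qed
  ultimately show ?thesis by (simp add: target_portfolio_corr_def)
qed

end

theorem corollary2:
  fixes M :: "'a measure"
    and X \<epsilon> Y W\<^sub>0 W\<^sub>\<alpha> :: "int \<Rightarrow> 'a \<Rightarrow> real"
    and \<rho> \<alpha> \<eta> :: real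
    and t :: int
  assumes "prob_space M"
    and "prob_space.indep_vars M (\<lambda>_. borel) X UNIV"
    and "\<And>s. distributed M lborel (X s) std_normal_density"
    and "prob_space.indep_vars M (\<lambda>_. borel) \<epsilon> UNIV"
    and "\<And>s. distributed M lborel (\<epsilon> s) std_normal_density"
    and "prob_space.indep_var M (\<Pi>\<^sub>M s\<in>UNIV. borel) (\<lambda>\<omega> s. X s \<omega>)
                                (\<Pi>\<^sub>M s\<in>UNIV. borel) (\<lambda>\<omega> s. \<epsilon> s \<omega>)"
    and "0 < \<rho>" and "\<rho> < 1"
    and "0 < \<alpha>" and "\<alpha> < 1"
    and "\<eta> > 0"
    and "Y = target \<rho> X \<epsilon>"
    and "threshold_portfolio M \<eta> (ema 0 X) W\<^sub>0"
    and "threshold_portfolio M \<eta> (ema \<alpha> X) W\<^sub>\<alpha>"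
  shows "target_portfolio_corr M W\<^sub>0 Y t > target_portfolio_corr M W\<^sub>\<alpha> Y t \<and>
         (target_portfolio_corr M W\<^sub>0 Y t - target_portfolio_corr M W\<^sub>\<alpha> Y t)
           / target_portfolio_corr M W\<^sub>\<alpha> Y t > improvement_bound \<alpha> \<eta>"
proof -
  interpret prob_space M by (rule assms(1))
  interpret raw: gaussian_ema M X 0 \<eta>
    by unfold_locales (use assms in auto)
  interpret smooth: gaussian_ema M X \<alpha> \<eta>
    by unfold_locales (use assms in auto)
  define K0 K where "K0 = target_portfolio_corr M W\<^sub>0 Y t" and "K = target_portfolio_corr M W\<^sub>\<alpha> Y t"
  define D where "D = coin_flip_ratio \<alpha> \<eta>"
  have lim0: "(\<lambda>n. \<rho> * expectation (\<lambda>\<omega>. raw.V n t \<omega> * X t \<omega>)) \<longlonglongrightarrow> K0"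
    unfolding K0_def assms(12) by (rule raw.corr_limit[OF assms(5,6,13)])
  have lim: "(\<lambda>n. \<rho> * expectation (\<lambda>\<omega>. smooth.V n t \<omega> * X t \<omega>)) \<longlonglongrightarrow> K"
    unfolding K_def assms(12) by (rule smooth.corr_limit[OF assms(5,6,14)])
  have "(\<lambda>n. \<rho> * expectation (\<lambda>\<omega>. raw.V (Suc n) t \<omega> * X t \<omega>)) \<longlonglongrightarrow> K0"
    using lim0 by (rule LIMSEQ_Suc)
  then have K0: "K0 = \<rho> * (2 * std_normal_density \<eta>)"
    unfolding raw.corr_raw[OF refl] by (simp add: LIMSEQ_const_iff)
  have K0_pos: "0 < K0" using K0 \<open>0 < \<rho>\<close> by (simp add: normal_density_pos)
  obtain \<delta> where \<delta>: "\<delta> > 0" "\<And>n. \<delta> \<le> expectation (\<lambda>\<omega>. smooth.V (Suc n) t \<omega> * X t \<omega>)"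
    using smooth.corr_pos[of t] by blast
  have "\<rho> * \<delta> \<le> K"
    by (rule LIMSEQ_le_const[OF LIMSEQ_Suc[OF lim]]) (use \<delta> \<open>0 < \<rho>\<close> in auto)
  with \<delta> \<open>0 < \<rho>\<close> have K_pos: "0 < K" by (smt (verit) mult_pos_pos)
  obtain \<delta>' where \<delta>': "\<delta>' > 0" "\<And>n. expectation (\<lambda>\<omega>. smooth.V (Suc (Suc (Suc n))) t \<omega> * X t \<omega>) \<le> 2 * std_normal_density \<eta> * D - \<delta>'"
    using smooth.corr_upper[OF \<open>0 < \<alpha>\<close>, of t] unfolding D_def by blast
  have "K \<le> \<rho> * (2 * std_normal_density \<eta> * D - \<delta>')"
    by (rule LIMSEQ_le_const2[OF LIMSEQ_Suc[OF LIMSEQ_Suc[OF LIMSEQ_Suc[OF lim]]]])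
      (use \<delta>'(2) \<open>0 < \<rho>\<close> in \<open>auto intro!: mult_left_mono simp del: recent_sign.simps\<close>)
  also have "\<dots> < K0 * D"
    using \<delta>' \<open>0 < \<rho>\<close> by (simp add: K0 algebra_simps)
  finally have KD: "K < K0 * D" .
  with K_pos have "0 < K0 * D" by linarith
  with K0_pos have D_pos: "0 < D" by (simp add: zero_less_mult_iff)
  have D_less: "D < 1"
    unfolding D_def using assms by (intro coin_flip_ratio_less_1) auto
  have "K0 * D < K0 * 1" using D_less K0_pos by (intro mult_strict_left_mono)
  with KD have 1: "K < K0" by linarith
  have "improvement_bound \<alpha> \<eta> = (1 - D) / D"
    by (simp add: improvement_bound_def D_def coin_flip_ratio_def algebra_simps)
  also have "\<dots> = 1 / D - 1" using D_pos by (simp add: field_simps)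
  \<comment> \<open>\<open>K < K0 * D\<close> says that \<open>1 / D < K0 / K\<close>.\<close>
  also have "\<dots> < K0 / K - 1" using KD D_pos K_pos by (simp add: field_simps)
  also have "\<dots> = (K0 - K) / K" using K_pos by (simp add: field_simps)
  finally show ?thesis using 1 unfolding K0_def K_def by simp
qed

end
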